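(* Let $G=(V,E,w)$ be a finite connected weighted graph with graph Laplacian $L$ and eigenvalues $\lambda_1\le\cdots\le\lambda_{|V|}$. Let $\psi$ be an eigenvector of $L$ that is non-zero at every vertex, with eigenvalue $\lambda_k$, where $k=\min\{m: L\psi=\lambda_m\psi\}$. Let $P=\sum_{(i,j)\in E_\pm}P_{ij}$ and $L_\sigma=L+\sigma P$ for $\sigma\in[0,1]$. Then the nodal domain count $\nu(\psi)$ is the multiplicity of $\lambda_k$ in the spectrum of $L_1=L+P$, and the nodal deficiency $\delta(\psi)=k-\nu(\psi)$ is precisely the number of eigenvalue branches of $L_\sigma$ that cross $\lambda_k$.
   Context: $G=(V,E,w)$ is a finite connected weighted undirected graph without self-loops or multiple edges, with weights $w_{ij}=w_{ji}>0$ on edges and $w_{ij}=0$ for non-edges. Its graph Laplacian is $L=D-W$ with $W=(w_{ij})$ and $D$ the diagonal matrix with entries $\sum_j w_{ij}$. Its eigenvalues are listed with multiplicity as $0=\lambda_1\le\lambda_2\le\cdots\le\lambda_{|V|}$. The sign-change edges are $E_\pm=\{(i,j)\in E:\psi_i\psi_j<0\}$ (unordered edges, each counted once in sums), and $q_{ij}=-\psi_i/\psi_j$. For $(i,j)\in E_\pm$, $P_{ij}$ is the $|V|\times|V|$ symmetric matrix with $(i,i)$ entry $w_{ij}q_{ji}$, $(j,j)$ entry $w_{ij}q_{ij}$, $(i,j)$ and $(j,i)$ entries $w_{ij}$, and all other entries zero. The nodal domains of $\psi$ are the connected components of $(V,E\setminus E_\pm)$, and $\nu(\psi)$ is their number.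 An eigenvalue branch is one of the $|V|$ real-analytic functions $\sigma\mapsto\lambda_i(\sigma)$, $\sigma\in[0,1]$, which together give the eigenvalues of $L_\sigma$ with multiplicity for every $\sigma$. A branch crosses $\lambda_k$ if its value is strictly below $\lambda_k$ at $\sigma=0$ and strictly above $\lambda_k$ at $\sigma=1$. *)

theory Defs
  imports "HOL-Analysis.Analysis" "HOL-Computational_Algebra.Polynomial"
begin

text \<open>
  A weighted graph has the finite type \<open>'n\<close> as its vertex set, a set \<open>E\<close> of unordered edges and a
  weight matrix \<open>w\<close>. Since \<open>{i, i}\<close> is not a doubleton, there are no self-loops and the diagonal of
  \<open>w\<close> vanishes.
\<close>

definition weighted_graph :: "'n::finite set set \<Rightarrow> real^'n^'n \<Rightarrow> bool" where
  "weighted_graph E w \<longleftrightarrow>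
     (\<forall>e\<in>E. card e = 2) \<and>
     (\<forall>i j. w$i$j = w$j$i) \<and>
     (\<forall>i j. {i, j} \<in> E \<longrightarrow> w$i$j > 0) \<and>
     (\<forall>i j. {i, j} \<notin> E \<longrightarrow> w$i$j = 0)"

definition reachable :: "'n set set \<Rightarrow> ('n \<times> 'n) set" where
  "reachable E = {(i, j). {i, j} \<in> E}\<^sup>*"

definition connected_graph :: "'n set set \<Rightarrow> bool" where
  "connected_graph E \<longleftrightarrow> (\<forall>i j. (i, j) \<in> reachable E)"

definition connected_components :: "'n set set \<Rightarrow> 'n set set" where
  "connected_components E = UNIV // reachable E"

definition degree_matrix :: "real^'n^'n \<Rightarrow> real^'n^'n" where
  "degree_matrix w = (\<chi> i j. if i = j then (\<Sum>l\<in>UNIV. w$i$l) else 0)"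

definition laplacian :: "real^'n^'n \<Rightarrow> real^'n^'n" where
  "laplacian w = degree_matrix w - w"

definition is_eigenvector :: "real^'n^'n \<Rightarrow> real^'n \<Rightarrow> bool" where
  "is_eigenvector A x \<longleftrightarrow> x \<noteq> 0 \<and> (\<exists>\<mu>. A *v x = \<mu> *s x)"

definition charpoly :: "real^'n^'n \<Rightarrow> real poly" where
  "charpoly A = det (mat [:0, 1:] - (\<chi> i j. [:A$i$j:]))"

text \<open>
  The real eigenvalues with algebraic multiplicity. It is used for symmetric matrices only, where
  these are all \<open>CARD('n)\<close> eigenvalues and algebraic and geometric multiplicities agree.
\<close>

definition eigenvalues :: "real^'n^'n \<Rightarrow> real multiset" where
  "eigenvalues A = proots (charpoly A)"

text \<open>The \<open>m\<close>-th smallest eigenvalue, for \<open>1 \<le> m \<le> CARD('n)\<close>.\<close>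

definition nth_eigenvalue :: "real^'n^'n \<Rightarrow> nat \<Rightarrow> real" where
  "nth_eigenvalue A m = sorted_list_of_multiset (eigenvalues A) ! (m - 1)"

definition sign_change_edges :: "'n set set \<Rightarrow> real^'n \<Rightarrow> 'n set set" where
  "sign_change_edges E \<psi> = {{i, j} | i j. {i, j} \<in> E \<and> \<psi>$i * \<psi>$j < 0}"

definition nodal_domain_count :: "'n set set \<Rightarrow> real^'n \<Rightarrow> nat" where
  "nodal_domain_count E \<psi> = card (connected_components (E - sign_change_edges E \<psi>))"

definition q_ratio :: "real^'n \<Rightarrow> 'n \<Rightarrow> 'n \<Rightarrow> real" where
  "q_ratio \<psi> i j = - \<psi>$i / \<psi>$j"

definition pair_matrix :: "real^'n^'n \<Rightarrow> real^'n \<Rightarrow> 'n \<Rightarrow> 'n \<Rightarrow> real^'n^'n" where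
  "pair_matrix w \<psi> i j = (\<chi> a b.
     if a = i \<and> b = i then w$i$j * q_ratio \<psi> j i
     else if a = j \<and> b = j then w$i$j * q_ratio \<psi> i j
     else if a = i \<and> b = j \<or> a = j \<and> b = i then w$i$j
     else 0)"

text \<open>
  For symmetric \<open>w\<close> the matrix of a pair \<open>i \<noteq> j\<close> does not depend on the order of \<open>i\<close> and \<open>j\<close>, so it
  is a function of the unordered edge; see \<open>edge_matrix_doubleton\<close>.
\<close>

definition edge_matrix :: "real^'n^'n \<Rightarrow> real^'n \<Rightarrow> 'n set \<Rightarrow> real^'n^'n" where
  "edge_matrix w \<psi> e = (THE M. \<forall>i j. e = {i, j} \<longrightarrow> M = pair_matrix w \<psi> i j)"

lemma pair_matrix_commute:
  assumes "w$i$j = w$j$i" and "i \<noteq> j"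
  shows "pair_matrix w \<psi> i j = pair_matrix w \<psi> j i"
  using assms by (auto simp: pair_matrix_def vec_eq_iff)

lemma edge_matrix_doubleton:
  assumes "w$i$j = w$j$i" and "i \<noteq> j"
  shows "edge_matrix w \<psi> {i, j} = pair_matrix w \<psi> i j"
  unfolding edge_matrix_def
  by (rule the_equality) (auto simp: doubleton_eq_iff pair_matrix_commute[of w i j, OF assms])

definition perturbation :: "'n::finite set set \<Rightarrow> real^'n^'n \<Rightarrow> real^'n \<Rightarrow> real^'n^'n" where
  "perturbation E w \<psi> = (\<Sum>e\<in>sign_change_edges E \<psi>. edge_matrix w \<psi> e)"

definition laplacian_family ::
  "'n::finite set set \<Rightarrow> real^'n^'n \<Rightarrow> real^'n \<Rightarrow> real \<Rightarrow> real^'n^'n" where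
  "laplacian_family E w \<psi> \<sigma> = laplacian w + \<sigma> *\<^sub>R perturbation E w \<psi>"

text \<open>
  Only the values of \<open>f\<close> on \<open>S\<close> matter; at an endpoint of an interval \<open>S\<close> this says that \<open>f\<close> has a
  real-analytic extension across that endpoint.
\<close>

definition real_analytic_on :: "(real \<Rightarrow> real) \<Rightarrow> real set \<Rightarrow> bool" where
  "real_analytic_on f S \<longleftrightarrow>
     (\<forall>x\<in>S. \<exists>r>0. \<exists>a. \<forall>y\<in>S. \<bar>y - x\<bar> < r \<longrightarrow> (\<lambda>n. a n * (y - x) ^ n) sums f y)"

text \<open>
  \<open>\<beta> 1, \<dots>, \<beta> CARD('n)\<close> is a complete system of eigenvalue branches of \<open>A \<sigma>\<close>, \<open>0 \<le> \<sigma> \<le> 1\<close>. Such a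
  system is unique up to a permutation of its indices.
\<close>

definition eigenvalue_branches ::
  "(real \<Rightarrow> real^'n^'n) \<Rightarrow> (nat \<Rightarrow> real \<Rightarrow> real) \<Rightarrow> bool" where
  "eigenvalue_branches A \<beta> \<longleftrightarrow>
     (\<forall>i\<in>{1..CARD('n)}. real_analytic_on (\<beta> i) {0..1}) \<and>
     (\<forall>\<sigma>\<in>{0..1}. eigenvalues (A \<sigma>) = {# \<beta> i \<sigma>. i \<in># mset_set {1..CARD('n)} #})"

definition crosses :: "(real \<Rightarrow> real) \<Rightarrow> real \<Rightarrow> bool" where
  "crosses b \<mu> \<longleftrightarrow> b 0 < \<mu> \<and> \<mu> < b 1"

definition nodal_deficiency :: "'n set set \<Rightarrow> real^'n \<Rightarrow> nat \<Rightarrow> int" where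
  "nodal_deficiency E \<psi> k = int k - int (nodal_domain_count E \<psi>)"

end

theory Submission
  imports Defs "HOL-Complex_Analysis.Cauchy_Integral_Formula"
begin

text \<open>
  Write \<open>L \<psi> = \<mu> \<psi>\<close> and substitute \<open>x = \<psi> y\<close>, pointwise. For a symmetric matrix \<open>W\<close> let \<open>H W\<close> be
  \<open>diag (W \<psi> / \<psi>) - W\<close> (\<open>ground_state_matrix\<close>). It annihilates \<open>\<psi>\<close>, and by the ground state
  representation its quadratic form is half the sum of \<open>W$a$b * \<psi>$a * \<psi>$b * (y$a - y$b)\<^sup>2\<close> over all
  ordered pairs of vertices. The eigenvalue equation says \<open>L - \<mu> = H w\<close>, and the perturbation is
  \<open>P = - H V\<close>, where \<open>V\<close> is the part of \<open>w\<close> on the sign-change edges. Hence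
  \<open>L + \<sigma> P - \<mu> = H (w - \<sigma> V)\<close>, and all spectral information is read off from the signs of
  \<open>\<psi>$a * \<psi>$b\<close> (\<open>laplacian_family_spectrum\<close>):
  
  \<^item> At \<open>\<sigma> = 1\<close> only edges inside nodal domains are left. The form of \<open>L + P - \<mu>\<close> is nonnegative, and its
    kernel consists of the vectors with \<open>y\<close> constant on each nodal domain. So \<open>\<mu>\<close> is the smallest
    eigenvalue of \<open>L + P\<close>, and its multiplicity is the nodal domain count.
  \<^item> \<open>P\<close> is positive semidefinite, so the number of eigenvalues below any \<open>t\<close> does not increase with
    \<open>\<sigma>\<close>. On the kernel at \<open>\<sigma> = 1\<close>, the form of \<open>P\<close> vanishes only if \<open>y\<close> is also equal across
    sign-change edges; then \<open>x\<close> is a multiple of \<open>\<psi>\<close>, because the graph is connected. So for \<open>\<sigma> < 1\<close> at least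
    \<open>\<nu> - 1\<close> eigenvalues lie below \<open>\<mu>\<close>, where \<open>\<nu>\<close> is the nodal domain count.
  
  For the branches, monotonicity of the counting functions forces each branch to be nondecreasing
  (\<open>eigenvalue_branch_mono\<close>). Of the \<open>k - 1\<close> branches that start below \<open>\<mu>\<close>, none ends below \<open>\<mu>\<close>,
  and those that do not cross end at \<open>\<mu>\<close>. Exactly \<open>\<nu>\<close> branches end at \<open>\<mu>\<close>. Just before \<open>\<sigma> = 1\<close>, one of
  them equals \<open>\<mu>\<close>, since \<open>\<psi>\<close> is an eigenvector throughout, and the other \<open>\<nu> - 1\<close> are below. By analyticity
  the first one is constant, and by monotonicity the others start below \<open>\<mu>\<close>. So \<open>k - 1\<close> is the
  number of crossings plus \<open>\<nu> - 1\<close> (\<open>crossing_branches_count\<close>).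
  
  Eigenvalues are counted through the variational characterisation of \<open>eigenvalues_below\<close>, which
  rests on the spectral theorem for real symmetric matrices.
\<close>

section \<open>The spectral theorem for real symmetric matrices\<close>

text \<open>
  A maximiser \<open>v\<close> of the Rayleigh quotient on the unit sphere of \<open>W\<close>, with maximum \<open>\<mu>\<close>, is an
  eigenvector: the form of \<open>g = \<mu> - f\<close> is nonnegative on \<open>W\<close> and vanishes at \<open>v\<close>, so its derivative
  at \<open>v\<close> in the direction \<open>g v\<close>, which is \<open>2 (g v \<bullet> g v)\<close>, must vanish too.
\<close>

lemma selfadjoint_eigenvector_in_subspace:
  fixes f :: "'a::euclidean_space \<Rightarrow> 'a"
  assumes f: "linear f" and sa: "\<And>x y. f x \<bullet> y = x \<bullet> f y"
    and W: "subspace W" "f ` W \<subseteq> W" "dim W \<noteq> 0"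
  obtains v \<mu> where "v \<in> W" "norm v = 1" "f v = \<mu> *\<^sub>R v"
proof -
  obtain u where u: "u \<in> W" "u \<noteq> 0"
    using W(3) by (auto simp: dim_eq_0)
  define S where "S = W \<inter> sphere 0 1"
  have "u /\<^sub>R norm u \<in> S"
    using u W(1) by (auto simp: S_def subspace_scale)
  then have "S \<noteq> {}" by blast
  moreover have "compact S"
    unfolding S_def by (intro closed_Int_compact closed_subspace W(1)) auto
  moreover have "continuous_on S (\<lambda>x. x \<bullet> f x)"
    by (intro continuous_intros linear_continuous_on linear_conv_bounded_linear[THEN iffD1] f)
  ultimately obtain v where v: "v \<in> S" "\<And>x. x \<in> S \<Longrightarrow> x \<bullet> f x \<le> v \<bullet> f v"
    using continuous_attains_sup by metis
  define \<mu> where "\<mu> = v \<bullet> f v"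
  define g where "g x = \<mu> *\<^sub>R x - f x" for x
  have vW: "v \<in> W" and nv: "norm v = 1" using v by (auto simp: S_def)
  have g_nonneg: "0 \<le> x \<bullet> g x" if "x \<in> W" for x
  proof (cases "x = 0")
    case False
    have "x /\<^sub>R norm x \<in> S"
      using that False W(1) by (auto simp: S_def subspace_scale)
    then have "(x /\<^sub>R norm x) \<bullet> f (x /\<^sub>R norm x) \<le> \<mu>"
      unfolding \<mu>_def by (rule v)
    then have "(x \<bullet> f x) / (norm x)\<^sup>2 \<le> \<mu>"
      by (simp add: linear_scale[OF f] power2_eq_square divide_inverse mult_ac)
    then have "x \<bullet> f x \<le> \<mu> * (norm x)\<^sup>2"
      using False by (simp add: field_simps)
    then show ?thesis
      by (simp add: g_def inner_diff_right power2_norm_eq_inner)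
  qed (simp add: g_def linear_0[OF f])
  have gv0: "v \<bullet> g v = 0"
    using nv by (simp add: g_def inner_diff_right \<mu>_def norm_eq_1)
  have gW: "g v \<in> W"
    unfolding g_def using W vW by (intro subspace_diff subspace_scale) auto
  define y where "y = g v"
  have quad: "0 \<le> 2 * t * (y \<bullet> y) + t\<^sup>2 * (y \<bullet> g y)" for t
  proof -
    have "0 \<le> (v + t *\<^sub>R y) \<bullet> g (v + t *\<^sub>R y)"
      by (intro g_nonneg subspace_add subspace_scale W vW) (simp add: y_def gW)
    moreover have "g (v + t *\<^sub>R y) = g v + t *\<^sub>R g y"
      by (simp add: g_def linear_add[OF f] linear_scale[OF f] algebra_simps)
    moreover have "v \<bullet> g y = g v \<bullet> y"
      by (simp add: g_def inner_diff_right inner_diff_left sa)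
    ultimately show ?thesis
      using gv0 by (simp add: y_def inner_add_left inner_add_right power2_eq_square algebra_simps)
  qed
  have "y \<bullet> y = 0"
  proof (rule ccontr)
    assume "y \<bullet> y \<noteq> 0"
    then have pos: "y \<bullet> y > 0" by simp
    define c where "c = y \<bullet> g y"
    have "c \<ge> 0" unfolding c_def y_def by (rule g_nonneg) (rule gW)
    \<comment> \<open>A small negative step along \<open>y\<close>: the linear term of \<open>quad\<close> beats the quadratic one.\<close>
    define t where "t = - (y \<bullet> y) / (c + 1)"
    have "t < 0" using pos \<open>c \<ge> 0\<close> by (simp add: t_def divide_neg_pos)
    have "2 * (y \<bullet> y) + t * c > 0"
    proof -
      have "t * c = - (y \<bullet> y) * (c / (c + 1))" by (simp add: t_def)
      moreover have "(y \<bullet> y) * (c / (c + 1)) \<le> (y \<bullet> y) * 1"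
        using \<open>c \<ge> 0\<close> pos by (intro mult_left_mono) auto
      ultimately show ?thesis using pos by linarith
    qed
    then have "t * (2 * (y \<bullet> y) + t * c) < 0"
      using \<open>t < 0\<close> by (simp add: mult_neg_pos)
    with quad[of t] show False
      by (simp add: c_def power2_eq_square algebra_simps)
  qed
  then have "f v = \<mu> *\<^sub>R v" by (simp add: y_def g_def)
  with vW nv show thesis by (rule that)
qed

text \<open>
  The spectral theorem, by splitting off one eigenvector at a time: its orthogonal complement in \<open>W\<close>
  is again invariant because \<open>f\<close> is self-adjoint.
\<close>

lemma selfadjoint_orthonormal_eigenbasis:
  fixes f :: "'a::euclidean_space \<Rightarrow> 'a"
  assumes f: "linear f" and sa: "\<And>x y. f x \<bullet> y = x \<bullet> f y"
    and "subspace W" "f ` W \<subseteq> W"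
  shows "\<exists>B \<subseteq> W. pairwise orthogonal B \<and> (\<forall>v\<in>B. norm v = 1 \<and> (\<exists>\<mu>. f v = \<mu> *\<^sub>R v)) \<and> card B = dim W"
  using assms(3,4)
proof (induction "dim W" arbitrary: W)
  case 0
  then show ?case by (intro exI[of _ "{}"]) auto
next
  case (Suc n)
  have "dim W \<noteq> 0" using Suc.hyps(2) by linarith
  then obtain v \<mu> where v: "v \<in> W" "norm v = 1" "f v = \<mu> *\<^sub>R v"
    using selfadjoint_eigenvector_in_subspace[OF f sa Suc.prems] by blast
  define U where "U = {y \<in> W. \<forall>x \<in> span {v}. orthogonal x y}"
  have U: "U = {y \<in> W. v \<bullet> y = 0}"
    by (auto simp: U_def span_singleton orthogonal_def)
  have "v \<noteq> 0" using v by auto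
  have "dim U + dim (span {v}) = dim W"
    unfolding U_def using Suc.prems v(1)
    by (intro dim_subspace_orthogonal_to_vectors) (auto simp: span_minimal)
  then have dU: "dim U = n"
    using Suc.hyps(2) \<open>v \<noteq> 0\<close> by simp
  have sU: "subspace U"
  proof -
    have "subspace {y. v \<bullet> y = 0}" by (simp add: subspace_def inner_add_right)
    moreover have "U = W \<inter> {y. v \<bullet> y = 0}" unfolding U by blast
    ultimately show ?thesis using subspace_inter[OF Suc.prems(1)] by simp
  qed
  have fU: "f ` U \<subseteq> U"
  proof (intro image_subsetI)
    fix y assume "y \<in> U"
    then have y: "y \<in> W" "v \<bullet> y = 0" by (simp_all add: U)
    have "v \<bullet> f y = f v \<bullet> y" by (simp add: sa)
    then show "f y \<in> U" using y Suc.prems(2) by (auto simp: U v(3))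
  qed
  obtain B where B: "B \<subseteq> U" "pairwise orthogonal B"
      "\<forall>v\<in>B. norm v = 1 \<and> (\<exists>\<mu>. f v = \<mu> *\<^sub>R v)" "card B = dim U"
    using Suc.hyps(1)[OF dU[symmetric] sU fU] by blast
  have "v \<notin> B" using B(1) v(2) by (auto simp: U norm_eq_1)
  have "finite B"
  proof -
    have "0 \<notin> B" using B(3) by auto
    then show ?thesis
      using pairwise_orthogonal_independent[OF B(2)] independent_imp_finite by blast
  qed
  show ?case
  proof (intro exI[of _ "insert v B"] conjI)
    show "card (insert v B) = dim W"
      using \<open>finite B\<close> \<open>v \<notin> B\<close> B(4) dU Suc.hyps(2) by simp
    show "pairwise orthogonal (insert v B)"
      using B(1,2) unfolding pairwise_insert
      by (auto simp: U orthogonal_def inner_commute)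
  qed (use B v in \<open>auto simp: U\<close>)
qed

definition orthonormal_eigenbasis ::
  "real^'n^'n \<Rightarrow> ('n \<Rightarrow> real^'n) \<Rightarrow> ('n \<Rightarrow> real) \<Rightarrow> bool" where
  "orthonormal_eigenbasis A v d \<longleftrightarrow>
     (\<forall>i j. v i \<bullet> v j = (if i = j then 1 else 0)) \<and> (\<forall>i. A *v v i = d i *\<^sub>R v i)"

lemma symmetric_inner_commute:
  fixes A :: "real^'n^'n"
  assumes "transpose A = A"
  shows "(A *v x) \<bullet> y = x \<bullet> (A *v y)"
  using assms by (metis dot_lmul_matrix vector_transpose_matrix)

lemma symmetric_orthonormal_eigenbasis:
  fixes A :: "real^'n^'n"
  assumes "transpose A = A"
  obtains v d where "orthonormal_eigenbasis A v d"
proof -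
  obtain B where B: "pairwise orthogonal B"
      "\<forall>v\<in>B. norm v = 1 \<and> (\<exists>\<mu>. A *v v = \<mu> *\<^sub>R v)" "card B = CARD('n)"
    using selfadjoint_orthonormal_eigenbasis[of "(*v) A" UNIV] symmetric_inner_commute[OF assms]
    by auto
  have "finite B"
    using B(3) by (intro card_ge_0_finite) simp
  then obtain v where v: "bij_betw v (UNIV :: 'n set) B"
    using B(3) finite_same_card_bij[of "UNIV :: 'n set" B] by auto
  then have vB: "v i \<in> B" for i by (auto simp: bij_betw_def)
  have "\<forall>i. \<exists>\<mu>. A *v v i = \<mu> *\<^sub>R v i"
    using B(2) vB by blast
  then obtain d where d: "\<And>i. A *v v i = d i *\<^sub>R v i"
    using choice[of "\<lambda>i \<mu>. A *v v i = \<mu> *\<^sub>R v i"] by blast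
  have "v i \<bullet> v j = (if i = j then 1 else 0)" for i j
  proof (cases "i = j")
    case True
    then show ?thesis using B(2) vB[of j] by (simp add: norm_eq_1)
  next
    case False
    then have "v i \<noteq> v j" using v by (metis UNIV_I bij_betw_def inj_on_def)
    then show ?thesis using False B(1) vB by (simp add: pairwise_def orthogonal_def)
  qed
  with d show thesis by (intro that[of v d]) (simp add: orthonormal_eigenbasis_def)
qed

lemma dim_span_subfamily:
  assumes "orthonormal_eigenbasis A v d"
  shows "dim (span (v ` I)) = card I"
proof -
  have on: "v i \<bullet> v j = (if i = j then 1 else 0)" for i j
    using assms by (simp add: orthonormal_eigenbasis_def)
  have inj: "inj_on v I"
    by (rule inj_onI) (metis on zero_neq_one)
  have "independent (v ` I)"
  proof (rule pairwise_orthogonal_independent)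
    show "pairwise orthogonal (v ` I)"
      by (auto simp: pairwise_def orthogonal_def on)
    show "0 \<notin> v ` I" by (metis (no_types, lifting) imageE inner_zero_left on zero_neq_one)
  qed
  then show ?thesis using inj by (simp add: dim_eq_card_independent card_image)
qed

lemma inner_span_subfamily_complement:
  assumes "orthonormal_eigenbasis A v d" "x \<in> span (v ` I)" "i \<notin> I"
  shows "x \<bullet> v i = 0"
proof -
  have "span (v ` I) \<subseteq> {x. x \<bullet> v i = 0}"
    using assms(1,3)
    by (intro span_minimal) (auto simp: orthonormal_eigenbasis_def subspace_def inner_add_left)
  with assms(2) show ?thesis by auto
qed

lemma eigenbasis_expansion:
  assumes B: "orthonormal_eigenbasis A v d"
  shows "x = (\<Sum>i\<in>UNIV. (x \<bullet> v i) *\<^sub>R v i)"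
proof -
  have "dim (span (range v)) = CARD('a)" by (rule dim_span_subfamily[OF B])
  then have "span (range v) = UNIV"
    by (metis dim_eq_full dim_span DIM_cart DIM_real mult.right_neutral)
  have "y = 0" if "\<And>i. y \<bullet> v i = 0" for y
  proof -
    have "span (range v) \<subseteq> {x. y \<bullet> x = 0}"
      using that by (intro span_minimal) (auto simp: subspace_def inner_add_right)
    then have "y \<bullet> y = 0" using \<open>span (range v) = UNIV\<close> by blast
    then show ?thesis by simp
  qed
  moreover have "\<And>j. (x - (\<Sum>i\<in>UNIV. (x \<bullet> v i) *\<^sub>R v i)) \<bullet> v j = 0"
  proof -
    fix j
    have "(x \<bullet> v i) * (v i \<bullet> v j) = (if j = i then x \<bullet> v i else 0)" for i
      using B by (simp add: orthonormal_eigenbasis_def)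
    then show "(x - (\<Sum>i\<in>UNIV. (x \<bullet> v i) *\<^sub>R v i)) \<bullet> v j = 0"
      by (simp add: inner_diff_left inner_sum_left)
  qed
  ultimately have "x - (\<Sum>i\<in>UNIV. (x \<bullet> v i) *\<^sub>R v i) = 0" .
  then show ?thesis by simp
qed

lemma norm_in_eigenbasis:
  assumes "orthonormal_eigenbasis A v d"
  shows "x \<bullet> x = (\<Sum>i\<in>UNIV. (x \<bullet> v i)\<^sup>2)"
  by (subst (2) eigenbasis_expansion[OF assms, of x]) (simp add: inner_sum_right power2_eq_square)

lemma quadratic_form_in_eigenbasis:
  assumes "orthonormal_eigenbasis A v d"
  shows "x \<bullet> (A *v x) = (\<Sum>i\<in>UNIV. d i * (x \<bullet> v i)\<^sup>2)"
proof -
  have "A *v x = (\<Sum>i\<in>UNIV. (x \<bullet> v i) *\<^sub>R d i *\<^sub>R v i)"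
    using assms
    by (subst eigenbasis_expansion[OF assms, of x])
      (simp add: linear_sum[OF matrix_vector_mul_linear] matrix_vector_mult_scaleR
        orthonormal_eigenbasis_def)
  then show ?thesis by (simp add: inner_sum_right power2_eq_square mult_ac)
qed

lemma constant_poly_matrix_mult:
  fixes A B :: "'a::comm_ring_1^'n^'n"
  shows "(\<chi> i j. [:A$i$j:]) ** (\<chi> i j. [:B$i$j:]) = (\<chi> i j. [:(A ** B)$i$j:])"
proof -
  have "(\<Sum>k\<in>S. [:A$i$k * B$k$j:]) = [:\<Sum>k\<in>S. A$i$k * B$k$j:]" if "finite S" for S i j
    using that by induction auto
  then show ?thesis by (simp add: vec_eq_iff matrix_matrix_mult_def mult.commute)
qed

lemma matrix_mult_diff_left: "(A - B) ** C = A ** C - B ** (C :: 'a::comm_ring_1^'n^'m)"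
  by (simp add: vec_eq_iff matrix_matrix_mult_def left_diff_distrib sum_subtractf)

lemma matrix_mult_diff_right: "A ** (B - C) = A ** B - A ** (C :: 'a::comm_ring_1^'n^'m)"
  by (simp add: vec_eq_iff matrix_matrix_mult_def right_diff_distrib sum_subtractf)

text \<open>
  The matrix \<open>Q\<close> of eigenvectors diagonalises \<open>A\<close>, and it also conjugates the characteristic matrices
  over the polynomial ring, so the characteristic polynomial of \<open>A\<close> splits into the factors of the
  diagonal matrix. This is where the algebraic multiplicities in \<open>eigenvalues\<close> become geometric.
\<close>

lemma eigenvalues_eq_eigenbasis_values:
  fixes A :: "real^'n^'n"
  assumes B: "orthonormal_eigenbasis A v d"
  shows "eigenvalues A = image_mset d (mset_set UNIV)"
proof -
  define Q :: "real^'n^'n" where "Q = (\<chi> i j. v j $ i)"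
  define D :: "real^'n^'n" where "D = (\<chi> i j. if i = j then d i else 0)"
  have QQ: "transpose Q ** Q = mat 1"
    using B by (auto simp: vec_eq_iff Q_def matrix_matrix_mult_def transpose_def mat_def
        orthonormal_eigenbasis_def inner_vec_def)
  have AQ: "A ** Q = Q ** D"
  proof -
    have "(\<Sum>k\<in>UNIV. A$i$k * v j $ k) = v j $ i * d j" for i j
    proof -
      have "(A *v v j)$i = (d j *\<^sub>R v j)$i" using B by (simp add: orthonormal_eigenbasis_def)
      then show ?thesis by (simp add: matrix_vector_mult_def mult_ac)
    qed
    then show ?thesis
      by (simp add: vec_eq_iff Q_def D_def matrix_matrix_mult_def if_distrib cong: if_cong)
  qed
  let ?C = "\<lambda>M::real^'n^'n. (\<chi> i j. [:M$i$j:])"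
  let ?X = "mat [:0, 1:] :: real poly^'n^'n"
  have one: "?C (mat 1) = mat 1" by (simp add: vec_eq_iff mat_def one_pCons)
  have comm: "?X ** M = M ** ?X" for M :: "real poly^'n^'n"
    by (simp add: vec_eq_iff mat_def matrix_matrix_mult_def if_distrib if_distribR mult.commute
        cong: if_cong)
  have eq: "(?X - ?C A) ** ?C Q = ?C Q ** (?X - ?C D)"
    by (simp add: matrix_mult_diff_left matrix_mult_diff_right comm constant_poly_matrix_mult AQ)
  have "det (?C (transpose Q)) * det (?C Q) = 1"
    unfolding det_mul[symmetric] constant_poly_matrix_mult QQ one by simp
  then have "det (?C Q) \<noteq> 0" by auto
  moreover have "det (?X - ?C A) * det (?C Q) = det (?X - ?C D) * det (?C Q)"
    using arg_cong[OF eq, of det] by (simp add: det_mul mult.commute)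
  ultimately have "det (?X - ?C A) = det (?X - ?C D)" by simp
  also have "\<dots> = (\<Prod>i\<in>UNIV. (?X - ?C D)$i$i)"
    by (rule det_diagonal) (simp add: D_def mat_def)
  also have "\<dots> = (\<Prod>i\<in>UNIV. [:- d i, 1:])"
    by (simp add: D_def mat_def)
  finally have "charpoly A = (\<Prod>i\<in>UNIV. [:- d i, 1:])" by (simp add: charpoly_def)
  then have "eigenvalues A = (\<Sum>i\<in>UNIV. {#d i#})"
    by (simp add: eigenvalues_def proots_prod)
  also have "\<dots> = image_mset d (mset_set UNIV)"
    by (simp add: sum_unfold_sum_mset)
  finally show ?thesis .
qed


lemma size_eigenvalues:
  fixes A :: "real^'n^'n"
  assumes "transpose A = A"
  shows "size (eigenvalues A) = CARD('n)"
proof -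
  obtain v d where "orthonormal_eigenbasis A v d"
    using symmetric_orthonormal_eigenbasis[OF assms] .
  then show ?thesis by (simp add: eigenvalues_eq_eigenbasis_values)
qed

section \<open>Counting eigenvalues below a threshold\<close>

definition eigenvalues_below :: "real^'n^'n \<Rightarrow> real \<Rightarrow> nat" where
  "eigenvalues_below A t = size {# e \<in># eigenvalues A. e < t #}"

lemma eigenvalues_below_eigenbasis:
  assumes "orthonormal_eigenbasis A v d"
  shows "eigenvalues_below A t = card {i. d i < t}"
  by (simp add: eigenvalues_below_def eigenvalues_eq_eigenbasis_values[OF assms]
      filter_mset_image_mset filter_mset_mset_set)

text \<open>
  One half of the Courant-Fischer principle: a subspace of larger dimension would meet the span of the
  eigenvectors with eigenvalue at least \<open>t\<close>, on which the form is at least \<open>t (x \<bullet> x)\<close>.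
\<close>

lemma dim_le_eigenvalues_below:
  assumes "transpose A = A" "subspace S"
    and neg: "\<And>x. x \<in> S \<Longrightarrow> x \<noteq> 0 \<Longrightarrow> x \<bullet> (A *v x) < t * (x \<bullet> x)"
  shows "dim S \<le> eigenvalues_below A t"
proof -
  obtain v d where B: "orthonormal_eigenbasis A v d"
    using symmetric_orthonormal_eigenbasis[OF assms(1)] .
  define I where "I = {i. d i < t}"
  have "S \<inter> span (v ` (- I)) \<subseteq> {0}"
  proof
    fix x assume x: "x \<in> S \<inter> span (v ` (- I))"
    have 0: "x \<bullet> v i = 0" if "i \<in> I" for i
      using inner_span_subfamily_complement[OF B, of x "- I" i] that x by auto
    have "t * (x \<bullet> x) \<le> x \<bullet> (A *v x)"
      unfolding norm_in_eigenbasis[OF B] quadratic_form_in_eigenbasis[OF B] sum_distrib_left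
    proof (rule sum_mono)
      fix i
      show "t * (x \<bullet> v i)\<^sup>2 \<le> d i * (x \<bullet> v i)\<^sup>2"
      proof (cases "i \<in> I")
        case False
        then have "t \<le> d i" by (simp add: I_def)
        then show ?thesis by (rule mult_right_mono) simp
      qed (simp add: 0)
    qed
    then show "x \<in> {0}" using neg[of x] x by force
  qed
  then have "dim (S \<inter> span (v ` (- I))) = 0" by (simp only: dim_eq_0)
  then have "dim {x + y |x y. x \<in> S \<and> y \<in> span (v ` (- I))} = dim S + card (- I)"
    using dim_sums_Int[OF assms(2) subspace_span, of "v ` (- I)"] dim_span_subfamily[OF B, of "- I"]
    by linarith
  then have "dim S + card (- I) \<le> CARD('a)"
    using dim_subset_UNIV[of "{x + y |x y. x \<in> S \<and> y \<in> span (v ` (- I))}"] by simp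
  moreover have "card (- I) = CARD('a) - card I" by (simp add: Compl_eq_Diff_UNIV card_Diff_subset)
  moreover have "card I \<le> CARD('a)" by (simp add: card_mono)
  ultimately show ?thesis
    by (simp add: eigenvalues_below_eigenbasis[OF B] I_def)
qed

text \<open>
  Equality is reached by the span of the eigenvectors whose eigenvalue is below \<open>t\<close>.
\<close>

lemma eigenvalues_below_attained:
  assumes "transpose A = A"
  obtains S where "subspace S" "dim S = eigenvalues_below A t"
    and "\<And>x. x \<in> S \<Longrightarrow> x \<noteq> 0 \<Longrightarrow> x \<bullet> (A *v x) < t * (x \<bullet> x)"
proof -
  obtain v d where B: "orthonormal_eigenbasis A v d"
    using symmetric_orthonormal_eigenbasis[OF assms(1)] .
  define I where "I = {i. d i < t}"
  have "x \<bullet> (A *v x) < t * (x \<bullet> x)" if x: "x \<in> span (v ` I)" "x \<noteq> 0" for x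
  proof -
    have 0: "x \<bullet> v i = 0" if "i \<notin> I" for i
      using inner_span_subfamily_complement[OF B x(1) that] .
    have "\<exists>j. x \<bullet> v j \<noteq> 0"
    proof (rule ccontr)
      assume "\<nexists>j. x \<bullet> v j \<noteq> 0"
      then have "(\<Sum>i\<in>UNIV. (x \<bullet> v i) *\<^sub>R v i) = 0" by simp
      then show False using eigenbasis_expansion[OF B, of x] x(2) by metis
    qed
    then obtain j where j: "x \<bullet> v j \<noteq> 0" by blast
    then have "d j < t" using 0 by (auto simp: I_def)
    show ?thesis
      unfolding norm_in_eigenbasis[OF B] quadratic_form_in_eigenbasis[OF B] sum_distrib_left
    proof (rule sum_strict_mono_ex1)
      show "\<forall>i\<in>UNIV. d i * (x \<bullet> v i)\<^sup>2 \<le> t * (x \<bullet> v i)\<^sup>2"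
      proof
        fix i
        show "d i * (x \<bullet> v i)\<^sup>2 \<le> t * (x \<bullet> v i)\<^sup>2"
        proof (cases "i \<in> I")
          case True
          then have "d i \<le> t" by (simp add: I_def)
          then show ?thesis by (rule mult_right_mono) simp
        qed (simp add: 0)
      qed
      show "\<exists>i\<in>UNIV. d i * (x \<bullet> v i)\<^sup>2 < t * (x \<bullet> v i)\<^sup>2"
        using j \<open>d j < t\<close> by (intro bexI[of _ j]) auto
    qed simp
  qed
  then show thesis
    using that[of "span (v ` I)"] dim_span_subfamily[OF B, of I]
    by (simp add: eigenvalues_below_eigenbasis[OF B] I_def)
qed

lemma eigenvalues_below_antimono:
  assumes "transpose A = A" "transpose B = B"
    and "\<And>x. x \<bullet> (A *v x) \<le> x \<bullet> (B *v x)"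
  shows "eigenvalues_below B t \<le> eigenvalues_below A t"
proof -
  obtain S where S: "subspace S" "dim S = eigenvalues_below B t"
    and neg: "\<And>x. x \<in> S \<Longrightarrow> x \<noteq> 0 \<Longrightarrow> x \<bullet> (B *v x) < t * (x \<bullet> x)"
    using eigenvalues_below_attained[OF assms(2)] by metis
  show ?thesis
    unfolding S(2)[symmetric]
    by (rule dim_le_eigenvalues_below[OF assms(1) S(1)]) (rule le_less_trans[OF assms(3) neg])
qed

lemma count_eigenvalues_eq_dim_eigenspace:
  assumes "transpose A = A"
  shows "count (eigenvalues A) t = dim {x. A *v x = t *\<^sub>R x}"
proof -
  obtain v d where B: "orthonormal_eigenbasis A v d"
    using symmetric_orthonormal_eigenbasis[OF assms(1)] .
  have on: "v i \<bullet> v j = (if i = j then 1 else 0)" and Av: "A *v v i = d i *\<^sub>R v i" for i j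
    using B by (simp_all add: orthonormal_eigenbasis_def)
  define I where "I = {i. d i = t}"
  have "{x. A *v x = t *\<^sub>R x} = span (v ` I)"
  proof (intro equalityI subsetI)
    fix x assume "x \<in> {x. A *v x = t *\<^sub>R x}"
    then have "t * (x \<bullet> v i) = d i * (x \<bullet> v i)" for i
      using symmetric_inner_commute[OF assms, of x "v i"] by (simp add: Av)
    then have 0: "x \<bullet> v i = 0" if "i \<notin> I" for i
      using that unfolding I_def by auto
    have "(\<Sum>i\<in>UNIV. (x \<bullet> v i) *\<^sub>R v i) \<in> span (v ` I)"
    proof (rule span_sum)
      fix i
      show "(x \<bullet> v i) *\<^sub>R v i \<in> span (v ` I)"
        by (cases "i \<in> I") (simp_all add: 0 span_0 span_base span_scale)
    qed
    then show "x \<in> span (v ` I)" using eigenbasis_expansion[OF B, of x] by simp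
  next
    fix x assume x: "x \<in> span (v ` I)"
    have "subspace {x. A *v x = t *\<^sub>R x}"
      by (auto simp: subspace_def matrix_vector_right_distrib scaleR_right_distrib matrix_vector_mult_scaleR)
    then have "span (v ` I) \<subseteq> {x. A *v x = t *\<^sub>R x}"
      by (intro span_minimal) (auto simp: I_def Av)
    then show "x \<in> {x. A *v x = t *\<^sub>R x}" using x by blast
  qed
  moreover have "count (eigenvalues A) t = card I"
    by (simp add: eigenvalues_eq_eigenbasis_values[OF B] count_image_mset I_def vimage_def)
  ultimately show ?thesis using dim_span_subfamily[OF B, of I] by simp
qed

section \<open>The ground state representation\<close>

text \<open>
  In the coordinates \<open>y = x / \<psi>\<close> this is the Laplacian of the signed weights \<open>W$a$b * \<psi>$a * \<psi>$b\<close>.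
  The diagonal is chosen so that \<open>\<psi>\<close>, that is \<open>y = 1\<close>, lies in the kernel.
\<close>

definition ground_state_matrix :: "real^'n^'n \<Rightarrow> real^'n \<Rightarrow> real^'n^'n" where
  "ground_state_matrix W \<psi> =
     (\<chi> a b. (if a = b then (\<Sum>c\<in>UNIV. W$a$c * \<psi>$c) / \<psi>$a else 0) - W$a$b)"

lemma ground_state_matrix_mult_nth:
  assumes "\<forall>a. \<psi>$a \<noteq> 0"
  shows "(ground_state_matrix W \<psi> *v x)$a = (\<Sum>b\<in>UNIV. W$a$b * \<psi>$b * (x$a/\<psi>$a - x$b/\<psi>$b))"
proof -
  have "(ground_state_matrix W \<psi> *v x)$a =
      (\<Sum>c\<in>UNIV. W$a$c * \<psi>$c) / \<psi>$a * x$a - (\<Sum>b\<in>UNIV. W$a$b * x$b)"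
    by (simp add: ground_state_matrix_def matrix_vector_mult_def left_diff_distrib sum_subtractf
        mult_delta_left)
  also have "\<dots> = (\<Sum>b\<in>UNIV. W$a$b * \<psi>$b * (x$a/\<psi>$a) - W$a$b * x$b)"
    by (simp add: sum_subtractf sum_distrib_right sum_divide_distrib)
  also have "\<dots> = (\<Sum>b\<in>UNIV. W$a$b * \<psi>$b * (x$a/\<psi>$a - x$b/\<psi>$b))"
    using assms by (intro sum.cong) (simp_all add: right_diff_distrib)
  finally show ?thesis .
qed

text \<open>
  Averaging the form \<open>\<Sum> m a b * (y a * (y a - y b))\<close> with its copy in which \<open>a\<close> and \<open>b\<close> are exchanged
  completes the square, because \<open>m\<close> is symmetric. The sum runs over ordered pairs, hence the factor 2.
\<close>

lemma ground_state_representation: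
  assumes "\<forall>a. \<psi>$a \<noteq> 0" "transpose W = W"
  shows "2 * (x \<bullet> (ground_state_matrix W \<psi> *v x)) =
    (\<Sum>a\<in>UNIV. \<Sum>b\<in>UNIV. W$a$b * (\<psi>$a * \<psi>$b) * (x$a/\<psi>$a - x$b/\<psi>$b)\<^sup>2)"
proof -
  define y where "y a = x$a/\<psi>$a" for a
  define m where "m a b = W$a$b * (\<psi>$a * \<psi>$b)" for a b
  have W: "W$b$a = W$a$b" for a b
    using assms(2) by (metis transpose_def vec_lambda_beta)
  have m: "m b a = m a b" for a b by (simp add: m_def W mult.commute)
  have x: "x$a = \<psi>$a * y a" for a using assms(1) by (simp add: y_def)
  have T: "x \<bullet> (ground_state_matrix W \<psi> *v x) = (\<Sum>a\<in>UNIV. \<Sum>b\<in>UNIV. m a b * (y a * (y a - y b)))"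
    unfolding inner_vec_def ground_state_matrix_mult_nth[OF assms(1)] y_def[symmetric]
    by (simp add: x m_def sum_distrib_left mult_ac)
  also have "\<dots> = (\<Sum>b\<in>UNIV. \<Sum>a\<in>UNIV. m a b * (y a * (y a - y b)))"
    by (rule sum.swap)
  also have "\<dots> = (\<Sum>a\<in>UNIV. \<Sum>b\<in>UNIV. m a b * (y b * (y b - y a)))"
    by (simp add: m)
  finally have "2 * (x \<bullet> (ground_state_matrix W \<psi> *v x)) =
      (\<Sum>a\<in>UNIV. \<Sum>b\<in>UNIV. m a b * (y a * (y a - y b)) + m a b * (y b * (y b - y a)))"
    using T by (simp add: sum.distrib)
  also have "\<dots> = (\<Sum>a\<in>UNIV. \<Sum>b\<in>UNIV. m a b * (y a - y b)\<^sup>2)"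
    by (simp add: power2_eq_square algebra_simps)
  finally show ?thesis by (simp add: m_def y_def)
qed

lemma ground_state_form_nonneg:
  assumes "\<forall>a. \<psi>$a \<noteq> 0" "transpose W = W" "\<forall>a b. 0 \<le> W$a$b * (\<psi>$a * \<psi>$b)"
  shows "0 \<le> x \<bullet> (ground_state_matrix W \<psi> *v x)"
proof -
  have "0 \<le> 2 * (x \<bullet> (ground_state_matrix W \<psi> *v x))"
    unfolding ground_state_representation[OF assms(1,2)] using assms(3)
    by (intro sum_nonneg mult_nonneg_nonneg[OF _ zero_le_power2]) auto
  then show ?thesis by simp
qed

lemma ground_state_form_zero:
  assumes "\<forall>a. \<psi>$a \<noteq> 0" "transpose W = W" "\<forall>a b. 0 \<le> W$a$b * (\<psi>$a * \<psi>$b)"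
    and "x \<bullet> (ground_state_matrix W \<psi> *v x) = 0" "W$a$b \<noteq> 0"
  shows "x$a/\<psi>$a = x$b/\<psi>$b"
proof -
  define g where "g a b = W$a$b * (\<psi>$a * \<psi>$b) * (x$a/\<psi>$a - x$b/\<psi>$b)\<^sup>2" for a b
  have g: "0 \<le> g a b" for a b
    unfolding g_def using assms(3) by (intro mult_nonneg_nonneg[OF _ zero_le_power2]) auto
  have "(\<Sum>a\<in>UNIV. \<Sum>b\<in>UNIV. g a b) = 0"
    using ground_state_representation[OF assms(1,2), of x] assms(4) by (simp add: g_def)
  then have "(\<Sum>b\<in>UNIV. g a b) = 0"
    by (subst (asm) sum_nonneg_eq_0_iff) (auto simp: g intro!: sum_nonneg)
  then have "g a b = 0"
    by (subst (asm) sum_nonneg_eq_0_iff) (auto simp: g)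
  then show ?thesis using assms(1,5) by (simp add: g_def)
qed

lemma ground_state_kernel:
  assumes "\<forall>a. \<psi>$a \<noteq> 0" "transpose W = W" "\<forall>a b. 0 \<le> W$a$b * (\<psi>$a * \<psi>$b)"
  shows "ground_state_matrix W \<psi> *v x = 0 \<longleftrightarrow> (\<forall>a b. W$a$b \<noteq> 0 \<longrightarrow> x$a/\<psi>$a = x$b/\<psi>$b)"
proof
  assume "ground_state_matrix W \<psi> *v x = 0"
  then show "\<forall>a b. W$a$b \<noteq> 0 \<longrightarrow> x$a/\<psi>$a = x$b/\<psi>$b"
    using ground_state_form_zero[OF assms, of x] by (metis inner_zero_right)
next
  assume *: "\<forall>a b. W$a$b \<noteq> 0 \<longrightarrow> x$a/\<psi>$a = x$b/\<psi>$b"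
  have "W$a$b * \<psi>$b * (x$a/\<psi>$a - x$b/\<psi>$b) = 0" for a b
    using *[rule_format, of a b] by (cases "W$a$b = 0") simp_all
  then show "ground_state_matrix W \<psi> *v x = 0"
    unfolding vec_eq_iff ground_state_matrix_mult_nth[OF assms(1)]
    by (intro allI) (simp only: sum.neutral_const zero_index)
qed

definition sign_change_part :: "real^'n^'n \<Rightarrow> real^'n \<Rightarrow> real^'n^'n" where
  "sign_change_part W \<psi> = (\<chi> a b. if \<psi>$a * \<psi>$b < 0 then W$a$b else 0)"

lemma ground_state_matrix_diff:
  "ground_state_matrix (W - c *\<^sub>R W') \<psi> = ground_state_matrix W \<psi> - c *\<^sub>R ground_state_matrix W' \<psi>"
  by (simp add: vec_eq_iff ground_state_matrix_def sum_subtractf left_diff_distrib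
      sum_distrib_left diff_divide_distrib mult.assoc right_diff_distrib)

text \<open>
  The eigenvalue equation at the vertex \<open>a\<close>, divided by \<open>\<psi>$a\<close>, says that the degree of \<open>a\<close> is the
  ground state diagonal entry plus \<open>\<mu>\<close>.
\<close>

lemma laplacian_eq_ground_state_matrix:
  assumes "\<forall>a. \<psi>$a \<noteq> 0" "laplacian w *v \<psi> = \<mu> *\<^sub>R \<psi>"
  shows "laplacian w = ground_state_matrix w \<psi> + \<mu> *\<^sub>R mat 1"
proof -
  have "(\<Sum>l\<in>UNIV. w$a$l) = (\<Sum>c\<in>UNIV. w$a$c * \<psi>$c) / \<psi>$a + \<mu>" for a
  proof -
    have "\<mu> * \<psi>$a = (laplacian w *v \<psi>)$a" by (simp add: assms(2))
    also have "\<dots> = (\<Sum>l\<in>UNIV. w$a$l) * \<psi>$a - (\<Sum>c\<in>UNIV. w$a$c * \<psi>$c)"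
      by (simp add: laplacian_def degree_matrix_def matrix_vector_mult_def left_diff_distrib
          sum_subtractf mult_delta_left)
    finally show ?thesis using assms(1) by (simp add: field_simps)
  qed
  then show ?thesis
    by (simp add: vec_eq_iff laplacian_def degree_matrix_def ground_state_matrix_def mat_def)
qed

text \<open>
  The diagonal case is written as a sum over the possible other endpoint \<open>c\<close>, at most one of which
  contributes, so that summation over edges can be exchanged with summation over vertices.
\<close>

lemma edge_matrix_nth:
  assumes "weighted_graph E w" "e \<in> sign_change_edges E \<psi>"
  shows "edge_matrix w \<psi> e $ a $ b =
    (if a = b then \<Sum>c\<in>UNIV. if e = {a, c} then w$a$c * q_ratio \<psi> c a else 0
     else if e = {a, b} then w$a$b else 0)"
proof -
  obtain i j where e: "e = {i, j}" "{i, j} \<in> E"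
    using assms(2) by (auto simp: sign_change_edges_def)
  have "i \<noteq> j" using assms(1) e(2) by (auto simp: weighted_graph_def)
  have sym: "w$j$i = w$i$j" for i j using assms(1) by (simp add: weighted_graph_def)
  have "(\<Sum>c\<in>UNIV. if {i, j} = {a, c} then w$a$c * q_ratio \<psi> c a else 0) =
    (if a = i then w$i$j * q_ratio \<psi> j i else if a = j then w$i$j * q_ratio \<psi> i j else 0)"
  proof -
    consider "a = i" | "a = j" "a \<noteq> i" | "a \<noteq> i" "a \<noteq> j" by blast
    then show ?thesis
    proof cases
      case 1
      then have "{i, j} = {a, c} \<longleftrightarrow> c = j" for c using \<open>i \<noteq> j\<close> by (auto simp: doubleton_eq_iff)
      then show ?thesis using 1 by simp
    next
      case 2
      then have "{i, j} = {a, c} \<longleftrightarrow> c = i" for c using \<open>i \<noteq> j\<close> by (auto simp: doubleton_eq_iff)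
      then show ?thesis using 2 by (simp add: sym)
    next
      case 3
      then have "{i, j} \<noteq> {a, c}" for c by (auto simp: doubleton_eq_iff)
      then show ?thesis using 3 by simp
    qed
  qed
  note diag = this
  have "pair_matrix w \<psi> i j $ a $ b =
    (if a = b then \<Sum>c\<in>UNIV. if {i, j} = {a, c} then w$a$c * q_ratio \<psi> c a else 0
     else if {i, j} = {a, b} then w$a$b else 0)"
  proof (cases "a = b")
    case True
    then show ?thesis unfolding diag using \<open>i \<noteq> j\<close> by (simp add: pair_matrix_def)
  next
    case False
    have "{i, j} = {a, b} \<longleftrightarrow> a = i \<and> b = j \<or> a = j \<and> b = i"
      by (auto simp: doubleton_eq_iff)
    then show ?thesis using False sym[of i j] by (simp add: pair_matrix_def) blast
  qed
  then show ?thesis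
    unfolding e(1) edge_matrix_doubleton[of w i j, OF sym \<open>i \<noteq> j\<close>] .
qed

lemma sign_change_edge_iff:
  "{a, b} \<in> sign_change_edges E \<psi> \<longleftrightarrow> {a, b} \<in> E \<and> \<psi>$a * \<psi>$b < 0"
  by (auto simp: sign_change_edges_def doubleton_eq_iff mult.commute insert_commute)

lemma sum_matrix_nth: "(\<Sum>e\<in>S. M e) $ a $ b = (\<Sum>e\<in>S. M e $ a $ b)"
  by (simp add: sum_component)

text \<open>
  Off the diagonal each edge matrix restores the weight of its edge. On the diagonal, \<open>w$a$c * q_ratio \<psi> c a\<close>
  is \<open>- w$a$c * \<psi>$c / \<psi>$a\<close>, the contribution of \<open>c\<close> to the ground state diagonal with a minus sign.
\<close>

lemma perturbation_eq_ground_state_matrix: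
  assumes G: "weighted_graph E w" and nz: "\<forall>a. \<psi>$a \<noteq> 0"
  shows "perturbation E w \<psi> = - ground_state_matrix (sign_change_part w \<psi>) \<psi>"
proof -
  let ?S = "sign_change_edges E \<psi>"
  have w0: "w$a$b = 0" if "{a, b} \<notin> E" for a b
    using G that by (simp add: weighted_graph_def)
  have offdiag: "perturbation E w \<psi> $ a $ b = sign_change_part w \<psi> $ a $ b" if "a \<noteq> b" for a b
  proof -
    have "perturbation E w \<psi> $ a $ b = (\<Sum>e\<in>?S. if e = {a, b} then w$a$b else 0)"
      unfolding perturbation_def sum_matrix_nth using that edge_matrix_nth[OF G]
      by (intro sum.cong) simp_all
    also have "\<dots> = sign_change_part w \<psi> $ a $ b"
      using w0[of a b] by (simp add: sign_change_edge_iff sign_change_part_def)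
    finally show ?thesis .
  qed
  have diag: "perturbation E w \<psi> $ a $ a = - (\<Sum>c\<in>UNIV. sign_change_part w \<psi> $ a $ c * \<psi>$c) / \<psi>$a" for a
  proof -
    have "perturbation E w \<psi> $ a $ a =
        (\<Sum>e\<in>?S. \<Sum>c\<in>UNIV. if e = {a, c} then w$a$c * q_ratio \<psi> c a else 0)"
      unfolding perturbation_def sum_matrix_nth using edge_matrix_nth[OF G]
      by (intro sum.cong) simp_all
    also have "\<dots> = (\<Sum>c\<in>UNIV. \<Sum>e\<in>?S. if e = {a, c} then w$a$c * q_ratio \<psi> c a else 0)"
      by (rule sum.swap)
    also have "\<dots> = (\<Sum>c\<in>UNIV. - (sign_change_part w \<psi> $ a $ c * \<psi>$c) / \<psi>$a)"
    proof (rule sum.cong[OF refl])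
      fix c
      show "(\<Sum>e\<in>?S. if e = {a, c} then w$a$c * q_ratio \<psi> c a else 0) =
          - (sign_change_part w \<psi> $ a $ c * \<psi>$c) / \<psi>$a"
        using w0[of a c] by (simp add: sign_change_edge_iff sign_change_part_def q_ratio_def)
    qed
    also have "\<dots> = - (\<Sum>c\<in>UNIV. sign_change_part w \<psi> $ a $ c * \<psi>$c) / \<psi>$a"
      by (simp add: sum_divide_distrib sum_negf)
    finally show ?thesis .
  qed
  have "perturbation E w \<psi> $ a $ b = - ground_state_matrix (sign_change_part w \<psi>) \<psi> $ a $ b" for a b
  proof (cases "a = b")
    case True
    have "sign_change_part w \<psi> $ b $ b = 0"
      by (simp add: sign_change_part_def not_less)
    then show ?thesis using True diag[of b] by (simp add: ground_state_matrix_def)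
  next
    case False
    then show ?thesis using offdiag by (simp add: ground_state_matrix_def)
  qed
  then show ?thesis by (simp add: vec_eq_iff)
qed

lemma laplacian_family_eq_ground_state_matrix:
  assumes "weighted_graph E w" "\<forall>a. \<psi>$a \<noteq> 0" "laplacian w *v \<psi> = \<mu> *\<^sub>R \<psi>"
  shows "laplacian_family E w \<psi> \<sigma> =
    ground_state_matrix (w - \<sigma> *\<^sub>R sign_change_part w \<psi>) \<psi> + \<mu> *\<^sub>R mat 1"
  unfolding laplacian_family_def perturbation_eq_ground_state_matrix[OF assms(1,2)]
    laplacian_eq_ground_state_matrix[OF assms(2,3)] ground_state_matrix_diff
  by simp

lemma transpose_ground_state_matrix:
  assumes "transpose W = W"
  shows "transpose (ground_state_matrix W \<psi>) = ground_state_matrix W \<psi>"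
proof -
  have "W$b$a = W$a$b" for a b
    using assms by (metis transpose_def vec_lambda_beta)
  then show ?thesis by (simp add: vec_eq_iff transpose_def ground_state_matrix_def)
qed

section \<open>Spectrum of the Laplacian family\<close>

lemma equiv_reachable: "equiv UNIV (reachable E)"
proof (rule equivI)
  have "sym {(i, j). {i, j} \<in> E}" by (auto simp: sym_def insert_commute)
  then show "sym (reachable E)" unfolding reachable_def by (rule sym_rtrancl)
qed (auto simp: reachable_def refl_rtrancl trans_rtrancl)

lemma constant_on_reachable:
  assumes "\<And>a b. {a, b} \<in> E \<Longrightarrow> f a = f b" "(a, b) \<in> reachable E"
  shows "f a = f b"
  using assms(2) unfolding reachable_def
  by induction (use assms(1) in auto)

text \<open>
  The restrictions of \<open>\<psi>\<close> to the classes of \<open>r\<close> have disjoint supports, so they form an orthogonal basis.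
\<close>

lemma dim_constant_on_classes:
  fixes \<psi> :: "real^'n"
  assumes r: "equiv UNIV r" and nz: "\<forall>a. \<psi>$a \<noteq> 0"
  shows "dim {x. \<forall>a b. (a, b) \<in> r \<longrightarrow> x$a/\<psi>$a = x$b/\<psi>$b} = card (UNIV // r)"
proof -
  define K where "K = {x. \<forall>a b. (a, b) \<in> r \<longrightarrow> x$a/\<psi>$a = x$b/\<psi>$b}"
  define u :: "'n set \<Rightarrow> real^'n" where "u C = (\<chi> a. if a \<in> C then \<psi>$a else 0)" for C
  let ?Q = "UNIV // r"
  have orth: "u C \<bullet> u D = 0" if "C \<in> ?Q" "D \<in> ?Q" "C \<noteq> D" for C D
  proof -
    have "C \<inter> D = {}" using quotient_disj[OF r that(1,2)] that(3) by blast
    then have "u C $ a * u D $ a = 0" for a by (auto simp: u_def)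
    then show ?thesis unfolding inner_vec_def inner_real_def by (simp only: sum.neutral_const)
  qed
  have u_nz: "u C \<noteq> 0" if C: "C \<in> ?Q" for C
  proof -
    obtain a where "a \<in> C" using in_quotient_imp_non_empty[OF r C] by blast
    then have "u C $ a \<noteq> 0" using nz by (simp add: u_def)
    then show ?thesis by auto
  qed
  have inj: "inj_on u ?Q"
  proof (rule inj_onI, rule ccontr)
    fix C D assume "C \<in> ?Q" "D \<in> ?Q" "u C = u D" "C \<noteq> D"
    then show False using orth[of C D] u_nz[of D] by simp
  qed
  have "independent (u ` ?Q)"
  proof (rule pairwise_orthogonal_independent)
    show "pairwise orthogonal (u ` ?Q)"
      unfolding pairwise_def orthogonal_def using orth by blast
    show "0 \<notin> u ` ?Q" using u_nz by auto
  qed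
  moreover have "u ` ?Q \<subseteq> K"
  proof (intro image_subsetI)
    fix C assume C: "C \<in> ?Q"
    have "a \<in> C \<longleftrightarrow> b \<in> C" if "(a, b) \<in> r" for a b
      using in_quotient_imp_closed[OF r C] that equivE[OF r] by (metis symD)
    then show "u C \<in> K" using nz by (auto simp: K_def u_def)
  qed
  moreover have "K \<subseteq> span (u ` ?Q)"
  proof
    fix x assume x: "x \<in> K"
    define rep where "rep C = (SOME a. a \<in> C)" for C :: "'n set"
    have rep: "rep C \<in> C" if "C \<in> ?Q" for C
      unfolding rep_def using in_quotient_imp_non_empty[OF r that] by (simp add: some_in_eq)
    have "x = (\<Sum>C\<in>?Q. (x$rep C / \<psi>$rep C) *\<^sub>R u C)"
    proof (unfold vec_eq_iff, rule allI)
      fix a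
      define D where "D = r `` {a}"
      have D: "D \<in> ?Q" "a \<in> D"
        unfolding D_def using equiv_class_self[OF r] by (auto intro: quotientI)
      have "(\<Sum>C\<in>?Q. (x$rep C / \<psi>$rep C) *\<^sub>R u C) $ a = (\<Sum>C\<in>?Q. (x$rep C / \<psi>$rep C) * u C $ a)"
        by (simp add: sum_component)
      also have "\<dots> = (\<Sum>C\<in>?Q. if C = D then x$a else 0)"
      proof (rule sum.cong[OF refl])
        fix C assume C: "C \<in> ?Q"
        show "(x$rep C / \<psi>$rep C) * u C $ a = (if C = D then x$a else 0)"
        proof (cases "C = D")
          case True
          have "(a, rep D) \<in> r" using rep[OF D(1)] by (simp add: D_def)
          then have "x$a/\<psi>$a = x$rep D / \<psi>$rep D" using x unfolding K_def by blast
          then have "x$rep D / \<psi>$rep D * \<psi>$a = x$a" using nz by (metis nonzero_eq_divide_eq)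
          then show ?thesis using True D(2) by (simp add: u_def)
        next
          case False
          then have "a \<notin> C" using quotient_disj[OF r C D(1)] D(2) by blast
          then show ?thesis using False by (simp add: u_def)
        qed
      qed
      also have "\<dots> = x$a" using D(1) by simp
      finally show "x$a = (\<Sum>C\<in>?Q. (x$rep C / \<psi>$rep C) *\<^sub>R u C) $ a" by simp
    qed
    also have "\<dots> \<in> span (u ` ?Q)" by (intro span_sum span_scale span_base) auto
    finally show "x \<in> span (u ` ?Q)" .
  qed
  ultimately have "dim K = card (u ` ?Q)" by (intro dim_unique[of "u ` ?Q"]) auto
  then show ?thesis by (simp add: K_def card_image[OF inj])
qed

text \<open>
  The spectral facts about the family that determine the branches, with \<open>V\<close> the sign-change part of
  \<open>w\<close>, \<open>R = w - V\<close>, and \<open>P\<close> the perturbation. The products \<open>R$a$b * \<psi>$a * \<psi>$b\<close> and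
  \<open>- V$a$b * \<psi>$a * \<psi>$b\<close> are nonnegative, so \<open>P\<close> is positive semidefinite and \<open>\<mu>\<close> is the bottom of the
  spectrum at \<open>\<sigma> = 1\<close>. There, an eigenvector of \<open>\<mu>\<close> is a multiple of \<open>\<psi>\<close> on each nodal domain. On
  these vectors, the form of \<open>P\<close> penalises different multiples across sign-change edges, so by connectedness
  it vanishes on the multiples of \<open>\<psi>\<close> only. Going back from \<open>1\<close> to \<open>\<sigma>\<close> therefore pushes the form below \<open>\<mu>\<close>
  on a subspace of codimension one of the eigenspace, which is the last claim.
\<close>

lemma laplacian_family_spectrum:
  fixes E :: "'n::finite set set" and w :: "real^'n^'n"
  assumes G: "weighted_graph E w" and conn: "connected_graph E"
    and nz: "\<forall>a. \<psi>$a \<noteq> 0" and eig: "laplacian w *v \<psi> = \<mu> *\<^sub>R \<psi>"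
  defines "A \<equiv> laplacian_family E w \<psi>"
  shows "transpose (A \<sigma>) = A \<sigma>"
    and "\<mu> \<in># eigenvalues (A \<sigma>)"
    and "\<sigma> \<le> \<tau> \<Longrightarrow> eigenvalues_below (A \<tau>) t \<le> eigenvalues_below (A \<sigma>) t"
    and "eigenvalues_below (A 1) \<mu> = 0"
    and "count (eigenvalues (A 1)) \<mu> = nodal_domain_count E \<psi>"
    and "\<sigma> < 1 \<Longrightarrow> count (eigenvalues (A 1)) \<mu> \<le> Suc (eigenvalues_below (A \<sigma>) \<mu>)"
proof -
  define V where "V = sign_change_part w \<psi>"
  define R where "R = w - V"
  have wsym: "transpose w = w" using G by (simp add: weighted_graph_def vec_eq_iff transpose_def)
  have Vsym: "transpose V = V"
    using G by (simp add: V_def sign_change_part_def weighted_graph_def vec_eq_iff transpose_def mult.commute)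
  have Wsym: "transpose (w - \<sigma> *\<^sub>R V) = w - \<sigma> *\<^sub>R V" for \<sigma>
    using wsym Vsym by (simp add: transpose_def vec_eq_iff)
  have Rsym: "transpose R = R" using Wsym[of 1] by (simp add: R_def)
  have wnn: "0 \<le> w$a$b" for a b
    using G by (cases "{a, b} \<in> E") (auto simp: weighted_graph_def less_imp_le)
  have R_nonneg: "\<forall>a b. 0 \<le> R$a$b * (\<psi>$a * \<psi>$b)"
    using wnn by (auto simp: R_def V_def sign_change_part_def not_less)
  have V_nonneg: "\<forall>a b. 0 \<le> (- V)$a$b * (\<psi>$a * \<psi>$b)"
    using wnn by (auto simp: V_def sign_change_part_def mult_nonneg_nonpos)
  have "transpose (- V) = - V" using Vsym by (simp add: transpose_def vec_eq_iff)
  have A: "A \<sigma> = ground_state_matrix (w - \<sigma> *\<^sub>R V) \<psi> + \<mu> *\<^sub>R mat 1" for \<sigma>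
    unfolding A_def V_def by (rule laplacian_family_eq_ground_state_matrix[OF G nz eig])
  define P where "P = ground_state_matrix (- V) \<psi>"
  have P_neg: "P = - ground_state_matrix V \<psi>"
    using ground_state_matrix_diff[of 0 1 V \<psi>] ground_state_matrix_diff[of 0 0 0 \<psi>]
    by (simp add: P_def ground_state_matrix_def vec_eq_iff)
  have AP: "A \<sigma> = A \<tau> + (\<sigma> - \<tau>) *\<^sub>R P" for \<sigma> \<tau>
    unfolding A ground_state_matrix_diff P_neg by (simp add: algebra_simps)
  have form: "x \<bullet> (A \<sigma> *v x) = x \<bullet> (A \<tau> *v x) + (\<sigma> - \<tau>) * (x \<bullet> (P *v x))" for x \<sigma> \<tau>
    unfolding AP[of \<sigma> \<tau>] matrix_vector_mult_add_rdistrib scaleR_matrix_vector_assoc[symmetric]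
    by (simp add: inner_add_right)
  have P_nonneg: "0 \<le> x \<bullet> (P *v x)" for x
    unfolding P_def by (rule ground_state_form_nonneg[OF nz \<open>transpose (- V) = - V\<close> V_nonneg])
  have A1: "A 1 *v x = ground_state_matrix R \<psi> *v x + \<mu> *\<^sub>R x" for x
    unfolding A by (simp add: R_def matrix_vector_mult_add_rdistrib scaleR_matrix_vector_assoc[symmetric])
  show sym: "transpose (A \<sigma>) = A \<sigma>" for \<sigma>
    using transpose_ground_state_matrix[OF Wsym, of \<sigma> \<psi>]
    by (simp add: A transpose_def vec_eq_iff mat_def)
  show "\<mu> \<in># eigenvalues (A \<sigma>)" for \<sigma>
  proof -
    have "ground_state_matrix W \<psi> *v \<psi> = 0" for W
      using nz by (simp add: vec_eq_iff ground_state_matrix_mult_nth)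
    then have "A \<sigma> *v \<psi> = \<mu> *\<^sub>R \<psi>"
      unfolding A by (simp add: matrix_vector_mult_add_rdistrib scaleR_matrix_vector_assoc[symmetric])
    moreover have "\<psi> \<noteq> 0" using nz by auto
    ultimately have "dim {x. A \<sigma> *v x = \<mu> *\<^sub>R x} \<noteq> 0" unfolding dim_eq_0 by blast
    then show ?thesis
      using count_eigenvalues_eq_dim_eigenspace[OF sym, of \<sigma> \<mu>] by (metis not_in_iff)
  qed
  show "\<sigma> \<le> \<tau> \<Longrightarrow> eigenvalues_below (A \<tau>) t \<le> eigenvalues_below (A \<sigma>) t" for \<sigma> \<tau> t
    using P_nonneg by (intro eigenvalues_below_antimono sym) (simp add: form[of _ \<tau> \<sigma>])
  show "eigenvalues_below (A 1) \<mu> = 0"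
  proof -
    obtain S where S: "subspace S" "dim S = eigenvalues_below (A 1) \<mu>"
      "\<And>x. x \<in> S \<Longrightarrow> x \<noteq> 0 \<Longrightarrow> x \<bullet> (A 1 *v x) < \<mu> * (x \<bullet> x)"
      using eigenvalues_below_attained[OF sym] by blast
    have "\<mu> * (x \<bullet> x) \<le> x \<bullet> (A 1 *v x)" for x
      using ground_state_form_nonneg[OF nz Rsym R_nonneg, of x] by (simp add: A1 inner_add_right)
    then have "x = 0" if "x \<in> S" for x
      using S(3)[OF that] by (meson not_less)
    then have "S \<subseteq> {0}" by blast
    then show ?thesis using S(2) by (simp only: dim_eq_0[symmetric])
  qed
  define F where "F = E - sign_change_edges E \<psi>"
  have w_iff: "w$a$b \<noteq> 0 \<longleftrightarrow> {a, b} \<in> E" for a b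
    using G unfolding weighted_graph_def by (metis less_irrefl)
  have R_iff: "R$a$b \<noteq> 0 \<longleftrightarrow> {a, b} \<in> F" for a b
    using w_iff[of a b] by (auto simp: R_def V_def sign_change_part_def F_def sign_change_edge_iff)
  have V_iff: "(- V)$a$b \<noteq> 0 \<longleftrightarrow> {a, b} \<in> sign_change_edges E \<psi>" for a b
    using w_iff[of a b] by (auto simp: V_def sign_change_part_def sign_change_edge_iff)
  define K where "K = {x. A 1 *v x = \<mu> *\<^sub>R x}"
  have K: "x \<in> K \<longleftrightarrow> (\<forall>a b. {a, b} \<in> F \<longrightarrow> x$a/\<psi>$a = x$b/\<psi>$b)" for x
    using ground_state_kernel[OF nz Rsym R_nonneg, of x] by (simp add: K_def A1 R_iff)
  have "K = {x. \<forall>a b. (a, b) \<in> reachable F \<longrightarrow> x$a/\<psi>$a = x$b/\<psi>$b}"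
  proof (intro set_eqI iffI)
    fix x assume "x \<in> K"
    then have "x$a/\<psi>$a = x$b/\<psi>$b" if "{a, b} \<in> F" for a b
      using that unfolding K by blast
    then show "x \<in> {x. \<forall>a b. (a, b) \<in> reachable F \<longrightarrow> x$a/\<psi>$a = x$b/\<psi>$b}"
      using constant_on_reachable[of F "\<lambda>a. x$a/\<psi>$a"] by blast
  next
    fix x assume "x \<in> {x. \<forall>a b. (a, b) \<in> reachable F \<longrightarrow> x$a/\<psi>$a = x$b/\<psi>$b}"
    then show "x \<in> K" unfolding K reachable_def by blast
  qed
  then have "dim K = card (UNIV // reachable F)"
    by (simp only: dim_constant_on_classes[OF equiv_reachable nz])
  then have dimK: "dim K = nodal_domain_count E \<psi>"
    by (simp add: nodal_domain_count_def connected_components_def F_def)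
  then show c: "count (eigenvalues (A 1)) \<mu> = nodal_domain_count E \<psi>"
    unfolding count_eigenvalues_eq_dim_eigenspace[OF sym] K_def .
  show "count (eigenvalues (A 1)) \<mu> \<le> Suc (eigenvalues_below (A \<sigma>) \<mu>)" if "\<sigma> < 1" for \<sigma>
  proof -
    have sK: "subspace K"
      by (auto simp: K_def subspace_def matrix_vector_right_distrib scaleR_right_distrib
          matrix_vector_mult_scaleR)
    \<comment> \<open>\<open>S\<close>, the orthogonal complement of \<open>\<psi>\<close> in the eigenspace, is the subspace on which the form is negative.\<close>
    have \<psi>K: "\<psi> \<in> K" using nz by (simp add: K)
    define S where "S = {y \<in> K. \<forall>x\<in>span {\<psi>}. orthogonal x y}"
    have S: "S = K \<inter> {y. \<psi> \<bullet> y = 0}"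
      by (auto simp: S_def span_singleton orthogonal_def)
    have "dim S + dim (span {\<psi>}) = dim K"
      unfolding S_def using sK \<psi>K
      by (intro dim_subspace_orthogonal_to_vectors) (auto simp: span_minimal)
    moreover have "dim (span {\<psi>}) \<le> 1"
      using dim_le_card[of "{\<psi>}" "{\<psi>}"] by (simp add: span_base)
    ultimately have "dim K \<le> Suc (dim S)" by simp
    moreover have "dim S \<le> eigenvalues_below (A \<sigma>) \<mu>"
    proof (rule dim_le_eigenvalues_below[OF sym])
      have "subspace {y. \<psi> \<bullet> y = 0}" by (simp add: subspace_def inner_add_right)
      then show "subspace S" unfolding S by (rule subspace_inter[OF sK])
      fix x assume x: "x \<in> S" "x \<noteq> 0"
      have "x \<bullet> (P *v x) \<noteq> 0"
      proof
        assume "x \<bullet> (P *v x) = 0"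
        then have across: "x$a/\<psi>$a = x$b/\<psi>$b" if "{a, b} \<in> sign_change_edges E \<psi>" for a b
          using ground_state_form_zero[OF nz \<open>transpose (- V) = - V\<close> V_nonneg, of x a b]
            V_iff[of a b] that by (simp add: P_def)
        have within: "x$a/\<psi>$a = x$b/\<psi>$b" if "{a, b} \<in> F" for a b
          using x(1) that unfolding S Int_iff K by blast
        have "x$a/\<psi>$a = x$b/\<psi>$b" if "{a, b} \<in> E" for a b
          using across within that unfolding F_def by blast
        then have const: "x$a/\<psi>$a = x$b/\<psi>$b" for a b
          using constant_on_reachable[of E "\<lambda>a. x$a/\<psi>$a" a b] conn
          unfolding connected_graph_def by blast
        define q where "q = x$undefined / \<psi>$undefined"
        have "x = q *\<^sub>R \<psi>"
          using const[of _ undefined] nz by (simp add: vec_eq_iff q_def field_simps)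
        then have "x \<bullet> x = q * (\<psi> \<bullet> x)" by simp
        then show False using x by (simp add: S)
      qed
      then have "x \<bullet> (P *v x) > 0" using P_nonneg[of x] by simp
      then have "(\<sigma> - 1) * (x \<bullet> (P *v x)) < 0" using that by (simp add: mult_neg_pos)
      moreover have "x \<bullet> (A 1 *v x) = \<mu> * (x \<bullet> x)" using x(1) by (simp add: S K_def)
      ultimately show "x \<bullet> (A \<sigma> *v x) < \<mu> * (x \<bullet> x)" by (simp add: form[of x \<sigma> 1])
    qed
    ultimately show ?thesis by (simp add: c dimK)
  qed
qed

section \<open>Real-analytic functions on an interval\<close>

lemma real_analytic_on_imp_continuous_on:
  fixes a b :: real
  assumes f: "real_analytic_on f {a..b}" and "a < b"
  shows "continuous_on {a..b} f"
  unfolding continuous_on_eq_continuous_within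
proof
  fix x assume x: "x \<in> {a..b}"
  then obtain r c where r: "r > 0"
    and c: "\<And>y. y \<in> {a..b} \<Longrightarrow> \<bar>y - x\<bar> < r \<Longrightarrow> (\<lambda>n. c n * (y - x) ^ n) sums f y"
    using f unfolding real_analytic_on_def by metis
  \<comment> \<open>Convergence at a second point of the interval gives the series a positive radius of convergence.\<close>
  define y0 where "y0 = (if x < b then min b (x + r/2) else max a (x - r/2))"
  have y0: "y0 \<in> {a..b}" "y0 \<noteq> x" "\<bar>y0 - x\<bar> < r"
    using x r \<open>a < b\<close> by (auto simp: y0_def min_def max_def)
  define g where "g h = (\<Sum>n. c n * h ^ n)" for h
  have "isCont g 0"
    unfolding g_def using c[OF y0(1,3)] y0(2)
    by (intro isCont_powser[of c "y0 - x"]) (auto dest: sums_summable)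
  then have "isCont (\<lambda>y. g (y - x)) x"
    by (intro isCont_o2[of x "\<lambda>y. y - x" g]) auto
  then have "continuous (at x within {a..b}) (\<lambda>y. g (y - x))"
    by (rule continuous_at_imp_continuous_at_within)
  then show "continuous (at x within {a..b}) f"
  proof (rule continuous_transform_within[OF _ r x])
    fix y assume "y \<in> {a..b}" "dist y x < r"
    then show "g (y - x) = f y"
      using c[of y] by (simp add: g_def dist_real_def sums_iff)
  qed
qed

text \<open>
  The identity theorem in the one-sided form that is needed. At the left end \<open>s\<close> of the maximal interval
  \<open>{s..b}\<close> of constancy, if \<open>a < s\<close>, the power series of \<open>f\<close> around \<open>s\<close> takes the value \<open>c\<close> at points
  accumulating at \<open>s\<close>, so it is constant and the interval extends further to the left.
\<close>

lemma real_analytic_on_constant: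
  fixes a b :: real
  assumes f: "real_analytic_on f {a..b}"
    and s0: "a \<le> s0" "s0 < b" "\<And>u. u \<in> {s0..b} \<Longrightarrow> f u = c"
  shows "\<And>u. u \<in> {a..b} \<Longrightarrow> f u = c"
proof -
  have "a < b" using s0 by simp
  have cont: "continuous_on {a..b} f"
    by (rule real_analytic_on_imp_continuous_on[OF f \<open>a < b\<close>])
  define T where "T = {z \<in> {a..b}. \<forall>u\<in>{z..b}. f u = c}"
  define s where "s = Inf T"
  have T: "s0 \<in> T" using s0 by (auto simp: T_def)
  have bdd: "bdd_below T" by (rule bdd_belowI[of _ a]) (auto simp: T_def)
  have "s \<le> s0" unfolding s_def using T bdd by (rule cInf_lower)
  have "a \<le> s" unfolding s_def using T by (intro cInf_greatest) (auto simp: T_def)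
  have "s < b" using \<open>s \<le> s0\<close> s0 by simp
  have right: "f u = c" if u: "u \<in> {s<..b}" for u
  proof -
    obtain t where "t \<in> T" "t < u"
      using cInf_lessD[of T u] T u unfolding s_def by auto
    then show ?thesis using u by (auto simp: T_def)
  qed
  have fs: "f s = c"
  proof (rule continuous_constant_on_closure[of "{s<..b}" f c s])
    show "continuous_on (closure {s<..b}) f"
      using cont \<open>s < b\<close> \<open>a \<le> s\<close> by (auto intro: continuous_on_subset)
  qed (use right \<open>s < b\<close> in auto)
  have "s = a"
  proof (rule ccontr)
    assume "s \<noteq> a"
    then have "a < s" using \<open>a \<le> s\<close> by simp
    obtain r p where r: "r > 0"
      and p: "\<And>y. y \<in> {a..b} \<Longrightarrow> \<bar>y - s\<bar> < r \<Longrightarrow> (\<lambda>n. p n * (y - s) ^ n) sums f y"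
      using f \<open>a \<le> s\<close> \<open>s < b\<close> unfolding real_analytic_on_def
      by (metis atLeastAtMost_iff less_eq_real_def)
    define \<rho> where "\<rho> = min r (min (s - a) (b - s))"
    have \<rho>: "\<rho> > 0" "\<rho> \<le> r" "\<rho> \<le> s - a" "\<rho> \<le> b - s"
      using r \<open>a < s\<close> \<open>s < b\<close> by (auto simp: \<rho>_def)
    define q where "q n = p n - (if n = 0 then c else 0)" for n
    have q: "(\<lambda>n. q n * (y - s) ^ n) sums (f y - c)" if "norm (y - s) < \<rho>" for y
    proof -
      have "(\<lambda>n. p n * (y - s) ^ n) sums f y"
        using that \<rho> by (intro p) (auto simp: abs_if split: if_splits)
      moreover have "(\<lambda>n. if n = 0 then c else 0) sums c"
        by (rule sums_single)
      ultimately have "(\<lambda>n. p n * (y - s) ^ n - (if n = 0 then c else 0)) sums (f y - c)"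
        by (rule sums_diff)
      moreover have "(\<lambda>n. p n * (y - s) ^ n - (if n = 0 then c else 0)) = (\<lambda>n. q n * (y - s) ^ n)"
        by (auto simp: q_def)
      ultimately show ?thesis by simp
    qed
    have q0: "q m = 0" if "m > 0" for m
    proof (rule ccontr)
      assume "q m \<noteq> 0"
      then obtain \<delta> where \<delta>: "0 < \<delta>" "\<And>z. z \<in> cball s \<delta> - {s} \<Longrightarrow> f z - c \<noteq> 0"
        using powser_0_nonzero[OF \<rho>(1) q, of m] fs \<open>m > 0\<close> by (metis diff_self)
      have "f (min (s + \<delta>) b) - c \<noteq> 0"
        using \<delta>(1) \<open>s < b\<close> by (intro \<delta>(2)) (auto simp: dist_real_def min_def)
      moreover have "f (min (s + \<delta>) b) = c"
        using \<delta>(1) \<open>s < b\<close> by (intro right) auto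
      ultimately show False by simp
    qed
    have const: "f y = c" if "norm (y - s) < \<rho>" for y
    proof -
      have "(\<lambda>n. q n * (y - s) ^ n) = (\<lambda>n. if n = 0 then q 0 else 0)" for y
        using q0 by (auto simp: fun_eq_iff)
      then have "(\<lambda>n. q n * (y - s) ^ n) sums q 0" for y
        using sums_single[of 0 "\<lambda>_. q 0"] by simp
      then have "f y - c = q 0" if "norm (y - s) < \<rho>" for y
        using q[OF that] sums_unique2 by blast
      from this[OF that] this[of s] show ?thesis using fs \<rho>(1) by simp
    qed
    have "s - \<rho>/2 \<in> T"
    proof -
      have "f u = c" if "u \<in> {s - \<rho>/2..b}" for u
        using that const[of u] right[of u] \<rho>(1) by (cases "u \<le> s") (auto simp: abs_if)
      then show ?thesis using \<rho> \<open>s < b\<close> by (auto simp: T_def)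
    qed
    then have "s \<le> s - \<rho>/2" unfolding s_def using bdd by (rule cInf_lower)
    then show False using \<rho>(1) by simp
  qed
  then show "\<And>u. u \<in> {a..b} \<Longrightarrow> f u = c"
    using right fs by (metis atLeastAtMost_iff greaterThanAtMost_iff less_eq_real_def)
qed

section \<open>Monotonicity and crossings of eigenvalue branches\<close>

text \<open>
  If \<open>f y < f x\<close>, consider the last point \<open>s\<close> of \<open>{x..y}\<close> with \<open>f x \<le> f s\<close>: right after \<open>s\<close> the values are
  still at least \<open>f s\<close>, which contradicts the choice of \<open>s\<close>.
\<close>

lemma mono_of_locally_right_mono:
  fixes f :: "real \<Rightarrow> real"
  assumes cont: "continuous_on {a..b} f"
    and loc: "\<And>s. a \<le> s \<Longrightarrow> s < b \<Longrightarrow> \<forall>\<^sub>F y in at s within {a..b}. s < y \<longrightarrow> f s \<le> f y"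
    and xy: "a \<le> x" "x \<le> y" "y \<le> b"
  shows "f x \<le> f y"
proof (rule ccontr)
  assume neg: "\<not> f x \<le> f y"
  define Z where "Z = {z \<in> {x..y}. f x \<le> f z}"
  have "continuous_on {x..y} f" using cont xy by (auto intro: continuous_on_subset)
  then have "closed ({x..y} \<inter> f -` {f x..})"
    by (intro continuous_closed_preimage) auto
  moreover have "Z = {x..y} \<inter> ({x..y} \<inter> f -` {f x..})" by (auto simp: Z_def)
  ultimately have "compact Z" by (metis compact_Int_closed compact_Icc)
  moreover have "x \<in> Z" using xy by (simp add: Z_def)
  ultimately obtain s where s: "s \<in> Z" and max: "\<And>z. z \<in> Z \<Longrightarrow> z \<le> s"
    using compact_attains_sup[of Z] by blast
  have "s \<noteq> y" using s neg by (auto simp: Z_def)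
  then have s': "x \<le> s" "s < y" "f x \<le> f s" using s by (auto simp: Z_def)
  obtain \<delta> where \<delta>: "\<delta> > 0"
    "\<And>z. z \<in> {a..b} \<Longrightarrow> z \<noteq> s \<Longrightarrow> dist z s < \<delta> \<Longrightarrow> s < z \<Longrightarrow> f s \<le> f z"
    using loc[of s] s' xy unfolding eventually_at by auto
  define z where "z = min y (s + \<delta>/2)"
  have z: "s < z" "z \<le> y" "dist z s < \<delta>"
    using s' \<delta>(1) by (auto simp: z_def dist_real_def min_def)
  then have "f s \<le> f z" using s' xy by (intro \<delta>(2)) auto
  then have "z \<in> Z" using z s' by (simp add: Z_def)
  then show False using max[of z] z by simp
qed

lemma eigenvalues_below_branches:
  fixes A :: "real \<Rightarrow> real^'n^'n"
  assumes "eigenvalue_branches A \<beta>" "\<sigma> \<in> {0..1}"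
  shows "eigenvalues_below (A \<sigma>) t = card {i \<in> {1..CARD('n)}. \<beta> i \<sigma> < t}"
proof -
  have "eigenvalues (A \<sigma>) = image_mset (\<lambda>i. \<beta> i \<sigma>) (mset_set {1..CARD('n)})"
    using assms by (simp add: eigenvalue_branches_def)
  then show ?thesis
    by (simp add: eigenvalues_below_def filter_mset_image_mset filter_mset_mset_set)
qed

text \<open>
  Monotone counting functions make every continuous branch monotone, without derivatives of eigenvalues.
  Put \<open>t = \<beta> i s\<close>. The branches below \<open>t\<close> at \<open>s\<close> stay below \<open>t\<close> for a short time by continuity, and
  their number cannot grow, so no other branch, in particular not \<open>\<beta> i\<close>, can drop below \<open>t\<close>
  immediately after \<open>s\<close>.
\<close>

lemma eigenvalue_branch_mono:
  fixes A :: "real \<Rightarrow> real^'n^'n"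
  assumes \<beta>: "eigenvalue_branches A \<beta>"
    and mono: "\<And>\<sigma> \<tau> t. 0 \<le> \<sigma> \<Longrightarrow> \<sigma> \<le> \<tau> \<Longrightarrow> \<tau> \<le> 1 \<Longrightarrow> eigenvalues_below (A \<tau>) t \<le> eigenvalues_below (A \<sigma>) t"
    and i: "i \<in> {1..CARD('n)}" and st: "0 \<le> \<sigma>" "\<sigma> \<le> \<tau>" "\<tau> \<le> 1"
  shows "\<beta> i \<sigma> \<le> \<beta> i \<tau>"
proof (rule mono_of_locally_right_mono[of 0 1 "\<beta> i"])
  have cont: "continuous_on {0..1} (\<beta> j)" if "j \<in> {1..CARD('n)}" for j
    using \<beta> that by (auto simp: eigenvalue_branches_def intro: real_analytic_on_imp_continuous_on)
  show "continuous_on {0..1} (\<beta> i)" by (rule cont[OF i])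
  fix s :: real assume s: "0 \<le> s" "s < 1"
  define t where "t = \<beta> i s"
  define J where "J = {j \<in> {1..CARD('n)}. \<beta> j s < t}"
  have "\<forall>\<^sub>F y in at s within {0..1}. \<beta> j y < t" if "j \<in> J" for j
  proof -
    have "(\<beta> j \<longlongrightarrow> \<beta> j s) (at s within {0..1})"
      using cont[of j] that s by (auto simp: J_def continuous_on_def)
    then show ?thesis using that by (auto simp: J_def intro: order_tendstoD)
  qed
  then have "\<forall>\<^sub>F y in at s within {0..1}. \<forall>j\<in>J. \<beta> j y < t"
    by (intro eventually_ball_finite) (auto simp: J_def)
  moreover have "\<forall>\<^sub>F y in at s within {0..1}. y \<in> {0..1}"
    by (simp add: eventually_at_filter)
  ultimately show "\<forall>\<^sub>F y in at s within {0..1}. s < y \<longrightarrow> \<beta> i s \<le> \<beta> i y"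
  proof eventually_elim
    case (elim y)
    show ?case
    proof
      assume "s < y"
      have "card {j \<in> {1..CARD('n)}. \<beta> j y < t} \<le> card J"
        using mono[of s y t] elim(2) s \<open>s < y\<close> eigenvalues_below_branches[OF \<beta>]
        by (simp add: J_def)
      moreover have "J \<subseteq> {j \<in> {1..CARD('n)}. \<beta> j y < t}"
        using elim(1) by (auto simp: J_def)
      ultimately have "J = {j \<in> {1..CARD('n)}. \<beta> j y < t}"
        by (intro card_seteq) auto
      moreover have "i \<notin> J" by (simp add: J_def t_def)
      ultimately show "\<beta> i s \<le> \<beta> i y" using i by (auto simp: t_def)
    qed
  qed
qed (use st in auto)

text \<open>
  Let \<open>M\<close> be the set of branches that end at \<open>\<mu>\<close>. All other branches end above \<open>\<mu>\<close> by \<open>bottom\<close>, and are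
  above \<open>\<mu>\<close> already at some \<open>s < 1\<close>. At this \<open>s\<close> all but at most one of the branches in \<open>M\<close> are below \<open>\<mu>\<close> by \<open>split\<close>,
  and one branch \<open>\<beta> j\<close> equals \<open>\<mu>\<close> by \<open>persistent\<close>; hence the branches below \<open>\<mu>\<close> at \<open>s\<close> are exactly those
  in \<open>M - {j}\<close>, and they are below \<open>\<mu>\<close> at \<open>0\<close> by monotonicity. The branch \<open>\<beta> j\<close> equals \<open>\<mu>\<close> on \<open>{s..1}\<close>
  by monotonicity, hence everywhere by analyticity. So the branches below \<open>\<mu>\<close> at \<open>0\<close> are those that
  cross \<open>\<mu>\<close> together with \<open>M - {j}\<close>.
\<close>

lemma crossing_branches_count:
  fixes A :: "real \<Rightarrow> real^'n^'n"
  assumes \<beta>: "eigenvalue_branches A \<beta>"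
    and mono: "\<And>\<sigma> \<tau> t. 0 \<le> \<sigma> \<Longrightarrow> \<sigma> \<le> \<tau> \<Longrightarrow> \<tau> \<le> 1 \<Longrightarrow> eigenvalues_below (A \<tau>) t \<le> eigenvalues_below (A \<sigma>) t"
    and persistent: "\<And>\<sigma>. 0 \<le> \<sigma> \<Longrightarrow> \<sigma> \<le> 1 \<Longrightarrow> \<mu> \<in># eigenvalues (A \<sigma>)"
    and bottom: "eigenvalues_below (A 1) \<mu> = 0"
    and split: "\<And>\<sigma>. 0 \<le> \<sigma> \<Longrightarrow> \<sigma> < 1 \<Longrightarrow>
      count (eigenvalues (A 1)) \<mu> \<le> Suc (eigenvalues_below (A \<sigma>) \<mu>)"
  shows "card {i \<in> {1..CARD('n)}. crosses (\<beta> i) \<mu>} + count (eigenvalues (A 1)) \<mu> =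
    Suc (eigenvalues_below (A 0) \<mu>)"
proof -
  define I where "I = {1..CARD('n)}"
  have fin: "finite I" by (simp add: I_def)
  have ev: "eigenvalues (A \<sigma>) = image_mset (\<lambda>i. \<beta> i \<sigma>) (mset_set I)" if "\<sigma> \<in> {0..1}" for \<sigma>
    using \<beta> that by (simp add: eigenvalue_branches_def I_def)
  have below: "eigenvalues_below (A \<sigma>) t = card {i \<in> I. \<beta> i \<sigma> < t}" if "\<sigma> \<in> {0..1}" for \<sigma> t
    using eigenvalues_below_branches[OF \<beta> that] by (simp add: I_def)
  have incr: "\<beta> i \<sigma> \<le> \<beta> i \<tau>" if "i \<in> I" "0 \<le> \<sigma>" "\<sigma> \<le> \<tau>" "\<tau> \<le> 1" for i \<sigma> \<tau>
    using eigenvalue_branch_mono[OF \<beta> mono] that by (auto simp: I_def)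
  have analytic: "real_analytic_on (\<beta> i) {0..1}" if "i \<in> I" for i
    using \<beta> that by (simp add: eigenvalue_branches_def I_def)
  define M where "M = {i \<in> I. \<beta> i 1 = \<mu>}"
  have "finite M" using fin by (simp add: M_def)
  have cM: "count (eigenvalues (A 1)) \<mu> = card M"
    using fin by (simp add: ev count_image_mset M_def vimage_def Int_def conj_commute)
  have ge: "\<mu> \<le> \<beta> i 1" if "i \<in> I" for i
  proof -
    have "{i \<in> I. \<beta> i 1 < \<mu>} = {}" using bottom below[of 1 \<mu>] fin by simp
    then show ?thesis using that by (auto simp: not_less)
  qed
  obtain s where s: "0 \<le> s" "s < 1" and away: "\<And>i. i \<in> I \<Longrightarrow> i \<notin> M \<Longrightarrow> \<mu> < \<beta> i s"
  proof -
    have "\<forall>\<^sub>F y in at 1 within {0..1}. \<mu> < \<beta> i y" if "i \<in> I - M" for i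
    proof -
      have "continuous_on {0..1} (\<beta> i)"
        using that analytic[of i] by (intro real_analytic_on_imp_continuous_on) auto
      then have "(\<beta> i \<longlongrightarrow> \<beta> i 1) (at 1 within {0..1})"
        by (simp add: continuous_on_def)
      moreover have "\<mu> < \<beta> i 1" using ge[of i] that by (auto simp: M_def)
      ultimately show ?thesis by (rule order_tendstoD)
    qed
    then have "\<forall>\<^sub>F y in at 1 within {0..1}. \<forall>i\<in>I - M. \<mu> < \<beta> i y"
      by (intro eventually_ball_finite) (auto simp: fin)
    then obtain \<delta> where \<delta>: "\<delta> > 0"
      "\<And>y. y \<in> {0..1} \<Longrightarrow> y \<noteq> 1 \<Longrightarrow> dist y 1 < \<delta> \<Longrightarrow> \<forall>i\<in>I - M. \<mu> < \<beta> i y"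
      unfolding eventually_at by blast
    show thesis
    proof (rule that[of "max 0 (1 - \<delta>/2)"])
      fix i assume "i \<in> I" "i \<notin> M"
      moreover have "\<forall>i\<in>I - M. \<mu> < \<beta> i (max 0 (1 - \<delta>/2))"
        using \<delta>(1) by (intro \<delta>(2)) (auto simp: dist_real_def max_def)
      ultimately show "\<mu> < \<beta> i (max 0 (1 - \<delta>/2))" by blast
    qed (use \<delta>(1) in auto)
  qed
  have "\<mu> \<in># eigenvalues (A s)" using persistent s by simp
  then obtain j where j: "j \<in> I" "\<beta> j s = \<mu>" using s fin by (auto simp: ev)
  then have "j \<in> M" using away[of j] by auto
  have low: "{i \<in> I. \<beta> i s < \<mu>} = M - {j}"
  proof (rule card_seteq)
    show "{i \<in> I. \<beta> i s < \<mu>} \<subseteq> M - {j}" using away j(2) by fastforce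
    have "card M \<le> Suc (card {i \<in> I. \<beta> i s < \<mu>})"
      using split[of s] s by (simp add: cM below)
    then show "card (M - {j}) \<le> card {i \<in> I. \<beta> i s < \<mu>}"
      using \<open>j \<in> M\<close> \<open>finite M\<close> by simp
  qed (simp add: \<open>finite M\<close>)
  have tail: "\<beta> j u = \<mu>" if "u \<in> {s..1}" for u
    using incr[of j s u] incr[of j u 1] that j s \<open>j \<in> M\<close> by (force simp: M_def)
  have j0: "\<beta> j 0 = \<mu>"
    by (rule real_analytic_on_constant[OF analytic[OF j(1)] s tail]) auto
  have M0: "\<beta> i 0 < \<mu>" if "i \<in> M - {j}" for i
  proof -
    have "i \<in> I" "\<beta> i s < \<mu>" using low that by blast+
    then show ?thesis using incr[of i 0 s] s by simp
  qed
  have "{i \<in> I. \<beta> i 0 < \<mu>} = {i \<in> I. crosses (\<beta> i) \<mu>} \<union> (M - {j})"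
  proof (intro equalityI subsetI)
    fix i assume "i \<in> {i \<in> I. \<beta> i 0 < \<mu>}"
    then show "i \<in> {i \<in> I. crosses (\<beta> i) \<mu>} \<union> (M - {j})"
      using ge[of i] j0 by (auto simp: crosses_def M_def)
  next
    fix i assume "i \<in> {i \<in> I. crosses (\<beta> i) \<mu>} \<union> (M - {j})"
    then show "i \<in> {i \<in> I. \<beta> i 0 < \<mu>}"
      using M0[of i] by (auto simp: crosses_def M_def)
  qed
  moreover have "{i \<in> I. crosses (\<beta> i) \<mu>} \<inter> (M - {j}) = {}"
    by (auto simp: crosses_def M_def)
  ultimately have "card {i \<in> I. \<beta> i 0 < \<mu>} = card {i \<in> I. crosses (\<beta> i) \<mu>} + card (M - {j})"
    using fin \<open>finite M\<close> by (simp add: card_Un_disjoint)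
  moreover have "card M = Suc (card (M - {j}))"
    using \<open>finite M\<close> \<open>j \<in> M\<close> by (simp only: card_Suc_Diff1)
  ultimately show ?thesis using below[of 0 \<mu>] by (simp add: cM I_def)
qed

section \<open>Nodal deficiency\<close>

text \<open>
  In the sorted list, the entries before the first occurrence of \<open>\<mu>\<close> are exactly those smaller than \<open>\<mu>\<close>.
  The index \<open>k\<close> counts from \<open>1\<close>.
\<close>

lemma first_index_of_sorted_value:
  fixes M :: "'a::linorder multiset"
  assumes "\<mu> \<in># M"
  defines "k \<equiv> Min {m \<in> {1..size M}. sorted_list_of_multiset M ! (m - 1) = \<mu>}"
  shows "sorted_list_of_multiset M ! (k - 1) = \<mu>" and "k = Suc (size {# e \<in># M. e < \<mu> #})"
proof -
  define xs where "xs = sorted_list_of_multiset M"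
  have len: "length xs = size M" and mset: "mset xs = M"
    by (simp_all add: xs_def size_mset[symmetric])
  have srt: "sorted xs" by (simp add: xs_def)
  define T where "T = {m \<in> {1..size M}. xs ! (m - 1) = \<mu>}"
  have k: "k = Min T" by (simp add: k_def T_def xs_def)
  have "\<mu> \<in> set xs" using assms(1) mset by (metis set_mset_mset)
  then obtain i where "i < length xs" "xs ! i = \<mu>" by (auto simp: in_set_conv_nth)
  then have "Suc i \<in> T" by (simp add: T_def len)
  moreover have "finite T" by (simp add: T_def)
  ultimately have kT: "k \<in> T" and least: "\<And>m. m \<in> T \<Longrightarrow> k \<le> m"
    unfolding k using Min_in by auto
  show "sorted_list_of_multiset M ! (k - 1) = \<mu>" using kT by (simp add: T_def xs_def)
  have k1: "1 \<le> k" "k \<le> length xs" "xs ! (k - 1) = \<mu>" using kT by (auto simp: T_def len)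
  have "{i. i < length xs \<and> xs ! i < \<mu>} = {..<k - 1}"
  proof (intro set_eqI iffI)
    fix i assume i: "i \<in> {i. i < length xs \<and> xs ! i < \<mu>}"
    show "i \<in> {..<k - 1}"
    proof (rule ccontr)
      assume "i \<notin> {..<k - 1}"
      then have "xs ! (k - 1) \<le> xs ! i" using i by (intro sorted_nth_mono[OF srt]) auto
      then have "\<mu> \<le> xs ! i" using k1(3) by simp
      then show False using i leD by blast
    qed
  next
    fix i assume i: "i \<in> {..<k - 1}"
    then have "xs ! i \<le> \<mu>" using k1 sorted_nth_mono[OF srt, of i "k - 1"] by auto
    moreover have "xs ! i \<noteq> \<mu>"
    proof
      assume "xs ! i = \<mu>"
      then have "Suc i \<in> T" using i k1 by (simp add: T_def len)
      then show False using least[of "Suc i"] i by simp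
    qed
    ultimately show "i \<in> {i. i < length xs \<and> xs ! i < \<mu>}" using i k1 by auto
  qed
  then have "length (filter (\<lambda>e. e < \<mu>) xs) = k - 1"
    by (simp add: length_filter_conv_card)
  moreover have "size {# e \<in># M. e < \<mu> #} = length (filter (\<lambda>e. e < \<mu>) xs)"
    by (metis mset mset_filter size_mset)
  ultimately show "k = Suc (size {# e \<in># M. e < \<mu> #})" using k1 by simp
qed

theorem theorem2p1:
  fixes E :: "'n::finite set set" and w :: "real^'n^'n" and \<psi> :: "real^'n" and k :: nat
  assumes "weighted_graph E w" and "connected_graph E"
    and "is_eigenvector (laplacian w) \<psi>" and "\<forall>i. \<psi>$i \<noteq> 0"
    and "k = Min {m \<in> {1..CARD('n)}. laplacian w *v \<psi> = nth_eigenvalue (laplacian w) m *s \<psi>}"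
  shows "nodal_domain_count E \<psi> =
           count (eigenvalues (laplacian w + perturbation E w \<psi>)) (nth_eigenvalue (laplacian w) k)
       \<and> (\<forall>\<beta>. eigenvalue_branches (laplacian_family E w \<psi>) \<beta> \<longrightarrow>
           nodal_deficiency E \<psi> k =
             int (card {i \<in> {1..CARD('n)}. crosses (\<beta> i) (nth_eigenvalue (laplacian w) k)}))"
proof -
  define L where "L = laplacian w"
  define A where "A = laplacian_family E w \<psi>"
  obtain \<mu> where "\<psi> \<noteq> 0" and \<mu>: "L *v \<psi> = \<mu> *s \<psi>"
    using assms(3) by (auto simp: is_eigenvector_def L_def)
  have "laplacian w *v \<psi> = \<mu> *\<^sub>R \<psi>"
    using \<mu> by (simp add: L_def scalar_mult_eq_scaleR)
  note spectrum = laplacian_family_spectrum[OF assms(1,2,4) this, folded A_def]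
  have A0: "A 0 = L" and A1: "A 1 = L + perturbation E w \<psi>"
    by (simp_all add: A_def L_def laplacian_family_def)
  have mem: "\<mu> \<in># eigenvalues L" using spectrum(2)[of 0] by (simp add: A0)
  have "size (eigenvalues L) = CARD('n)"
    using size_eigenvalues[OF spectrum(1)[of 0]] by (simp add: A0)
  then have "k = Min {m \<in> {1..size (eigenvalues L)}. sorted_list_of_multiset (eigenvalues L) ! (m - 1) = \<mu>}"
    unfolding assms(5) L_def[symmetric] \<mu> nth_eigenvalue_def using \<open>\<psi> \<noteq> 0\<close>
    by (simp add: vector_mul_rcancel eq_commute[of \<mu>])
  note k = first_index_of_sorted_value[OF mem, folded this]
  have nth: "nth_eigenvalue (laplacian w) k = \<mu>"
    using k(1) by (simp add: nth_eigenvalue_def L_def)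
  have \<nu>: "nodal_domain_count E \<psi> = count (eigenvalues (A 1)) \<mu>"
    by (rule spectrum(5)[symmetric])
  have "nodal_deficiency E \<psi> k = int (card {i \<in> {1..CARD('n)}. crosses (\<beta> i) \<mu>})"
    if "eigenvalue_branches A \<beta>" for \<beta>
  proof -
    have "card {i \<in> {1..CARD('n)}. crosses (\<beta> i) \<mu>} + count (eigenvalues (A 1)) \<mu> =
        Suc (eigenvalues_below (A 0) \<mu>)"
      by (rule crossing_branches_count[OF that]) (simp_all add: spectrum(2,3,4,6))
    then show ?thesis
      using k(2) by (simp add: nodal_deficiency_def \<nu> A0 eigenvalues_below_def)
  qed
  then show ?thesis
    unfolding nth A1[symmetric, unfolded L_def] A_def[symmetric] using \<nu> by blast
qed

end
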